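(* Suppose $0\le\alpha_3\le\alpha_2\le\alpha_1\le\pi/4$. Then $\mu(U(\alpha_1,\alpha_2,\alpha_3))=4$ if $(\alpha_1,\alpha_2,\alpha_3)\in\mathcal{S}_{\mathrm{EF}}$ and $\mu(U(\alpha_1,\alpha_2,\alpha_3))=5$ if $(\alpha_1,\alpha_2,\alpha_3)\in\mathcal{S}_{\mathrm{E}}$. Moreover, $U(\alpha_1,\alpha_2,\alpha_3)$ can be verified by an entanglement-free protocol iff $(\alpha_1,\alpha_2,\alpha_3)\in\mathcal{S}_{\mathrm{EF}}$.
   Context: $U(\alpha_1,\alpha_2,\alpha_3)=\exp[-i(\alpha_1\sigma_1\otimes\sigma_1+\alpha_2\sigma_2\otimes\sigma_2+\alpha_3\sigma_3\otimes\sigma_3)]$ is the canonical two-qubit unitary, where $\sigma_1,\sigma_2,\sigma_3$ are the Pauli operators. $\mathcal{S}=\{(\alpha_1,\alpha_2,\alpha_3): 0\le\alpha_3\le\alpha_2\le\alpha_1\le\pi/4\}$, $\mathcal{S}_{\mathrm{E}}=\{(\alpha,\alpha,\alpha): 0<\alpha<\pi/4\}$, and $\mathcal{S}_{\mathrm{EF}}=\mathcal{S}\setminus\mathcal{S}_{\mathrm{E}}$. A verification protocol for a unitary $U$ consists of pure product input test states and, for each output state $U|\psi_j\rangle$, a verification protocol based on nonadaptive local projective measurements; it is ordinary if each output-state verification operator has positive spectral gap. One experimental setting means the preparation of a pure product input state together with one nonadaptive local projective measurement on the output state; $\mu(U)$ is the minimum number of experimental settings required to verify $U$ by ordinary protocols.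 A verification protocol is entanglement free if all input test states and the corresponding output states are product states and all measurements are local projective measurements. *)

theory Defs
  imports Complex_Main "Jordan_Normal_Form.Matrix"
begin

definition adj :: "complex mat \<Rightarrow> complex mat" where
  "adj A = mat (dim_col A) (dim_row A) (\<lambda>(i,j). cnj (A $$ (j,i)))"

definition cinner :: "complex vec \<Rightarrow> complex vec \<Rightarrow> complex" where
  "cinner v w = (\<Sum>i<dim_vec v. cnj (v $ i) * w $ i)"

definition outer :: "complex vec \<Rightarrow> complex vec \<Rightarrow> complex mat" where
  "outer v w = mat (dim_vec v) (dim_vec w) (\<lambda>(i,j). v $ i * cnj (w $ j))"

definition unit_state :: "nat \<Rightarrow> complex vec \<Rightarrow> bool" where
  "unit_state n v \<longleftrightarrow> v \<in> carrier_vec n \<and> cinner v v = 1"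

text \<open>Kronecker (tensor) product of two qubit operators / two qubit vectors,
  with basis ordering |00>,|01>,|10>,|11>.\<close>
definition kron2 :: "complex mat \<Rightarrow> complex mat \<Rightarrow> complex mat" where
  "kron2 A B = mat 4 4 (\<lambda>(i,j). A $$ (i div 2, j div 2) * B $$ (i mod 2, j mod 2))"

definition kronv2 :: "complex vec \<Rightarrow> complex vec \<Rightarrow> complex vec" where
  "kronv2 a b = vec 4 (\<lambda>i. a $ (i div 2) * b $ (i mod 2))"

definition product_state :: "complex vec \<Rightarrow> bool" where
  "product_state v \<longleftrightarrow> (\<exists>a b. unit_state 2 a \<and> unit_state 2 b \<and> v = kronv2 a b)"

definition mexp :: "complex mat \<Rightarrow> complex mat" where
  "mexp A = mat (dim_row A) (dim_col A)
     (\<lambda>(i,j). \<Sum>k. (A ^\<^sub>m k) $$ (i,j) / of_nat (fact k))"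

definition sigma1 :: "complex mat" where
  "sigma1 = mat_of_rows_list 2 [[0, 1], [1, 0]]"
definition sigma2 :: "complex mat" where
  "sigma2 = mat_of_rows_list 2 [[0, -\<i>], [\<i>, 0]]"
definition sigma3 :: "complex mat" where
  "sigma3 = mat_of_rows_list 2 [[1, 0], [0, -1]]"

definition canonical_U :: "real \<Rightarrow> real \<Rightarrow> real \<Rightarrow> complex mat" where
  "canonical_U a1 a2 a3 = mexp ((- \<i>) \<cdot>\<^sub>m
      (of_real a1 \<cdot>\<^sub>m kron2 sigma1 sigma1 + of_real a2 \<cdot>\<^sub>m kron2 sigma2 sigma2
       + of_real a3 \<cdot>\<^sub>m kron2 sigma3 sigma3))"

definition S_region :: "(real \<times> real \<times> real) set" where
  "S_region = {(a1,a2,a3). 0 \<le> a3 \<and> a3 \<le> a2 \<and> a2 \<le> a1 \<and> a1 \<le> pi/4}"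

definition S_E :: "(real \<times> real \<times> real) set" where
  "S_E = {(a,a,a) | a. 0 < a \<and> a < pi/4}"

definition S_EF :: "(real \<times> real \<times> real) set" where
  "S_EF = S_region - S_E"

text \<open>A nonadaptive local projective measurement on two qubits: each party
  measures in an orthonormal basis of C^2 (a trivial measurement on a party is
  covered by accepting both of its outcomes).  A basis is given as a pair of
  vectors; the measurement is a pair of such bases.\<close>
type_synonym qbasis = "complex vec \<times> complex vec"
type_synonym lmeas = "qbasis \<times> qbasis"

definition onb2 :: "qbasis \<Rightarrow> bool" where
  "onb2 e \<longleftrightarrow> unit_state 2 (fst e) \<and> unit_state 2 (snd e) \<and> cinner (fst e) (snd e) = 0"

definition basis_vec :: "qbasis \<Rightarrow> nat \<Rightarrow> complex vec" where
  "basis_vec e x = (if x = 0 then fst e else snd e)"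

definition local_meas :: "lmeas \<Rightarrow> bool" where
  "local_meas M \<longleftrightarrow> onb2 (fst M) \<and> onb2 (snd M)"

definition test_op :: "lmeas \<Rightarrow> (nat \<times> nat) set \<Rightarrow> complex mat" where
  "test_op M S = mat 4 4 (\<lambda>(i,j). \<Sum>(x,y)\<in>S.
      outer (kronv2 (basis_vec (fst M) x) (basis_vec (snd M) y))
            (kronv2 (basis_vec (fst M) x) (basis_vec (snd M) y)) $$ (i,j))"

text \<open>A verification protocol for a two-qubit pure state based on nonadaptive
  local projective measurements: a list of measurement settings, each with a list
  of tests (accepting set, probability).  The number of settings is the length
  of the outer list.\<close>
type_synonym state_protocol = "(lmeas \<times> ((nat \<times> nat) set \<times> real) list) list"

definition total_prob :: "state_protocol \<Rightarrow> real" where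
  "total_prob sp = sum_list (map (\<lambda>(M,ts). sum_list (map snd ts)) sp)"

definition ver_op :: "state_protocol \<Rightarrow> complex mat" where
  "ver_op sp = mat 4 4 (\<lambda>(i,j).
      sum_list (map (\<lambda>(M,ts). sum_list (map (\<lambda>(S,p). of_real p * test_op M S $$ (i,j)) ts)) sp))"

definition valid_state_protocol :: "complex vec \<Rightarrow> state_protocol \<Rightarrow> bool" where
  "valid_state_protocol \<phi> sp \<longleftrightarrow>
     (\<forall>(M,ts)\<in>set sp. local_meas M \<and>
        (\<forall>(S,p)\<in>set ts. S \<subseteq> {0,1} \<times> {0,1} \<and> 0 \<le> p \<and> test_op M S *\<^sub>v \<phi> = \<phi>))
     \<and> total_prob sp = 1"

text \<open>Positive spectral gap: the verification operator (whose largest eigenvalue is 1,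
  attained at the target) has eigenvalue 1 with multiplicity one, i.e. its
  eigenspace for eigenvalue 1 is spanned by the target state.\<close>
definition positive_gap :: "complex vec \<Rightarrow> state_protocol \<Rightarrow> bool" where
  "positive_gap \<phi> sp \<longleftrightarrow>
     (\<forall>v \<in> carrier_vec 4. ver_op sp *\<^sub>v v = v \<longrightarrow> (\<exists>c. v = c \<cdot>\<^sub>v \<phi>))"

text \<open>A verification protocol for a two-qubit unitary: a list of pure product input
  test states a (x) b, each with a state verification protocol for its output.\<close>
type_synonym unitary_protocol = "((complex vec \<times> complex vec) \<times> state_protocol) list"

definition valid_protocol :: "complex mat \<Rightarrow> unitary_protocol \<Rightarrow> bool" where
  "valid_protocol U P \<longleftrightarrow>
     (\<forall>((a,b),sp)\<in>set P. unit_state 2 a \<and> unit_state 2 b \<and>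
         valid_state_protocol (U *\<^sub>v kronv2 a b) sp)"

definition ordinary :: "complex mat \<Rightarrow> unitary_protocol \<Rightarrow> bool" where
  "ordinary U P \<longleftrightarrow> (\<forall>((a,b),sp)\<in>set P. positive_gap (U *\<^sub>v kronv2 a b) sp)"

definition num_settings :: "unitary_protocol \<Rightarrow> nat" where
  "num_settings P = sum_list (map (\<lambda>(_,sp). length sp) P)"

definition mtrace :: "complex mat \<Rightarrow> complex" where
  "mtrace A = (\<Sum>i<dim_row A. A $$ (i,i))"

definition kraus :: "complex mat list \<Rightarrow> bool" where
  "kraus Ks \<longleftrightarrow> (\<forall>K\<in>set Ks. K \<in> carrier_mat 4 4) \<and>
      foldr (\<lambda>K acc. adj K * K + acc) Ks (0\<^sub>m 4 4) = 1\<^sub>m 4"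

definition channel :: "complex mat list \<Rightarrow> complex mat \<Rightarrow> complex mat" where
  "channel Ks \<rho> = foldr (\<lambda>K acc. K * \<rho> * adj K + acc) Ks (0\<^sub>m 4 4)"

definition passes_all :: "unitary_protocol \<Rightarrow> complex mat list \<Rightarrow> bool" where
  "passes_all P Ks \<longleftrightarrow> (\<forall>((a,b),sp)\<in>set P.
      mtrace (ver_op sp * channel Ks (outer (kronv2 a b) (kronv2 a b))) = 1)"

definition verifies :: "complex mat \<Rightarrow> unitary_protocol \<Rightarrow> bool" where
  "verifies U P \<longleftrightarrow> valid_protocol U P \<and>
     (\<forall>Ks. kraus Ks \<and> passes_all P Ks \<longrightarrow>
        (\<forall>\<rho>\<in>carrier_mat 4 4. channel Ks \<rho> = U * \<rho> * adj U))"

definition mu :: "complex mat \<Rightarrow> nat" where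
  "mu U = (LEAST n. \<exists>P. verifies U P \<and> ordinary U P \<and> num_settings P = n)"

text \<open>Entanglement free: input test states (product by construction) and all output
  states are product states; measurements are local projective by construction.\<close>
definition entanglement_free :: "complex mat \<Rightarrow> unitary_protocol \<Rightarrow> bool" where
  "entanglement_free U P \<longleftrightarrow> (\<forall>((a,b),sp)\<in>set P. product_state (U *\<^sub>v kronv2 a b))"

end

theory Submission
  imports Defs "Jordan_Normal_Form.Determinant"
begin

text \<open>
  A channel that passes an ordinary protocol has Kraus operators \<open>K\<close> with \<open>K\<psi>\<^sub>j = c\<^sub>K\<^sub>j U\<psi>\<^sub>j\<close> for all
  test states. If \<open>\<psi>\<^sub>0\<close> is not orthogonal to \<open>\<psi>\<^sub>j\<close>, comparing inner products gives the equality case of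
  Cauchy-Schwarz, so \<open>c\<^sub>K\<^sub>j\<close> does not depend on \<open>j\<close>; if the test states also span, \<open>K\<close> is a multiple of \<open>U\<close>.
  Conversely, if some \<open>w \<noteq> 0\<close> is orthogonal to all test states, \<open>U\<close> preceded by the reflection in
  \<open>w\<close> passes as well. Hence four test states are needed. An output state that is verified with one setting
  is a product state.

  \<open>U\<close> is diagonal in the magic basis, where the concurrence of \<open>\<Sum> m\<^sub>k \<Phi>\<^sub>k\<close> is \<open>|\<Sum> m\<^sub>k\<^sup>2|\<close>. Product states
  with product outputs are thus the solutions of two linear equations in the \<open>m\<^sub>k\<^sup>2\<close>, a set closed under
  sign changes of the \<open>m\<^sub>k\<close>. Unless \<open>a1 = a3\<close> there is a solution with all \<open>m\<^sub>k \<noteq> 0\<close>, and the sign changes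
  of it span. If \<open>a1 = a2 = a3 \<in> (0, pi/4)\<close>, the output of \<open>a \<otimes> b\<close> is entangled unless \<open>a\<close> and \<open>b\<close> are
  parallel, in which case \<open>a \<otimes> b\<close> is orthogonal to the singlet; so one of the test states has an entangled
  output, and it takes two settings.
\<close>

section \<open>The inner product\<close>

lemma cinner_add_right:
  "\<lbrakk>dim_vec v = dim_vec u; dim_vec w = dim_vec u\<rbrakk> \<Longrightarrow> cinner u (v + w) = cinner u v + cinner u w"
  by (simp add: cinner_def sum.distrib algebra_simps)

lemma cinner_diff_right:
  "\<lbrakk>dim_vec v = dim_vec u; dim_vec w = dim_vec u\<rbrakk> \<Longrightarrow> cinner u (v - w) = cinner u v - cinner u w"
  by (simp add: cinner_def sum_subtractf algebra_simps)

lemma cinner_diff_left: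
  "\<lbrakk>dim_vec v = dim_vec u; dim_vec w = dim_vec u\<rbrakk> \<Longrightarrow> cinner (v - w) u = cinner v u - cinner w u"
  by (simp add: cinner_def sum_subtractf algebra_simps)

lemma cinner_smult_right: "dim_vec v = dim_vec u \<Longrightarrow> cinner u (c \<cdot>\<^sub>v v) = c * cinner u v"
  by (simp add: cinner_def sum_distrib_left algebra_simps)

lemma cinner_smult_left: "cinner (c \<cdot>\<^sub>v u) v = cnj c * cinner u v"
  by (simp add: cinner_def sum_distrib_left algebra_simps)

lemma cinner_commute: "dim_vec v = dim_vec u \<Longrightarrow> cinner v u = cnj (cinner u v)"
  by (simp add: cinner_def mult.commute)

lemma cinner_self: "cinner v v = of_real (\<Sum>i<dim_vec v. (cmod (v $ i))\<^sup>2)"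
  unfolding cinner_def of_real_sum
  by (rule sum.cong) (simp_all add: complex_norm_square mult.commute del: of_real_power)

lemma Re_cinner_self: "cinner v v = of_real (Re (cinner v v))" "0 \<le> Re (cinner v v)"
  by (simp_all add: cinner_self sum_nonneg)

lemma cinner_self_eq_0: "cinner v v = 0 \<longleftrightarrow> v = 0\<^sub>v (dim_vec v)"
proof
  assume "cinner v v = 0"
  then have "(\<Sum>i<dim_vec v. (cmod (v $ i))\<^sup>2) = 0"
    unfolding cinner_self by (simp only: of_real_eq_0_iff)
  then have "\<forall>i<dim_vec v. v $ i = 0"
    by (subst (asm) sum_nonneg_eq_0_iff) auto
  then show "v = 0\<^sub>v (dim_vec v)" by auto
next
  assume "v = 0\<^sub>v (dim_vec v)"
  then have "\<forall>i<dim_vec v. v $ i = 0" by (metis index_zero_vec(1))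
  then show "cinner v v = 0" by (simp add: cinner_def)
qed

section \<open>Adjoints, isometries and orthogonal complements\<close>

lemma adj_carrier[simp]: "A \<in> carrier_mat n m \<Longrightarrow> adj A \<in> carrier_mat m n"
  by (auto simp: adj_def)

lemma mult_mat_vec_index:
  assumes "A \<in> carrier_mat n m" "w \<in> carrier_vec m" "i < n"
  shows "(A *\<^sub>v w) $ i = (\<Sum>j<m. A $$ (i,j) * w $ j)"
  using assms by (auto simp: scalar_prod_def atLeast0LessThan intro!: sum.cong)

lemma cinner_mult_mat_vec:
  assumes "A \<in> carrier_mat n m" "v \<in> carrier_vec n" "w \<in> carrier_vec m"
  shows "cinner v (A *\<^sub>v w) = cinner (adj A *\<^sub>v v) w"
proof -
  have "cinner v (A *\<^sub>v w) = (\<Sum>i<n. cnj (v $ i) * (\<Sum>j<m. A $$ (i,j) * w $ j))"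
    unfolding cinner_def using assms
    by (intro sum.cong) (auto simp del: index_mult_mat_vec simp: mult_mat_vec_index[OF assms(1,3)])
  also have "\<dots> = (\<Sum>j<m. (\<Sum>i<n. cnj (v $ i) * A $$ (i,j)) * w $ j)"
    unfolding sum_distrib_left sum_distrib_right by (subst sum.swap) (simp add: mult.assoc)
  also have "\<dots> = (\<Sum>j<m. cnj ((adj A *\<^sub>v v) $ j) * w $ j)"
    using assms
    by (intro sum.cong refl, subst mult_mat_vec_index[OF adj_carrier[OF assms(1)] assms(2)])
      (auto simp: adj_def mult.commute)
  also have "\<dots> = cinner (adj A *\<^sub>v v) w"
    using assms by (simp add: cinner_def adj_def)
  finally show ?thesis .
qed

lemma cinner_adj_mult:
  assumes "A \<in> carrier_mat n m" "v \<in> carrier_vec m" "w \<in> carrier_vec m"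
  shows "cinner v ((adj A * A) *\<^sub>v w) = cinner (A *\<^sub>v v) (A *\<^sub>v w)"
proof -
  have "adj (adj A) = A"
    using assms by (auto simp: adj_def)
  then show ?thesis
    using assms cinner_mult_mat_vec[of "adj A" m n v "A *\<^sub>v w"]
    by (simp add: assoc_mult_mat_vec[of "adj A" m n A m w] mult_mat_vec_carrier[of A n m])
qed

lemma isometry_cinner:
  assumes "U \<in> carrier_mat n m" "adj U * U = 1\<^sub>m m" "v \<in> carrier_vec m" "w \<in> carrier_vec m"
  shows "cinner (U *\<^sub>v v) (U *\<^sub>v w) = cinner v w"
  using cinner_adj_mult[OF assms(1,3,4)] assms by simp

text \<open>The conjugated vectors, padded with zero rows, form a square matrix. With fewer than
  \<open>n\<close> vectors the last row is zero, so the determinant vanishes and a kernel vector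
  exists.\<close>

lemma exists_orthogonal_vec:
  assumes "length ws < n" "set ws \<subseteq> carrier_vec n"
  obtains v where "v \<in> carrier_vec n" "v \<noteq> 0\<^sub>v n" "\<forall>w\<in>set ws. cinner w v = 0"
proof -
  define A where "A = mat n n (\<lambda>(i,j). if i < length ws then cnj (ws ! i $ j) else 0)"
  have A: "A \<in> carrier_mat n n" by (simp add: A_def)
  have "A = mat\<^sub>r n n (\<lambda>i. if i = n - 1 then 0\<^sub>v n else row A i)"
    using assms(1) by (intro eq_matI) (auto simp: A_def)
  moreover have "det (mat\<^sub>r n n (\<lambda>i. if i = n - 1 then 0\<^sub>v n else row A i)) = 0"
    using assms(1) A by (intro det_row_0) auto
  ultimately have "det A = 0" by simp
  then obtain v where v: "v \<in> carrier_vec n" "v \<noteq> 0\<^sub>v n" "A *\<^sub>v v = 0\<^sub>v n"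
    using det_0_iff_vec_prod_zero_field[OF A] by blast
  have "cinner w v = 0" if "w \<in> set ws" for w
  proof -
    obtain i where i: "i < length ws" "w = ws ! i"
      using \<open>w \<in> set ws\<close> by (metis in_set_conv_nth)
    have "cinner w v = (A *\<^sub>v v) $ i"
      using i assms that
      by (subst mult_mat_vec_index[OF A v(1)])
        (auto simp: cinner_def A_def carrier_vecD[of w n] subsetD intro!: sum.cong)
    then show ?thesis using v i assms by simp
  qed
  then show ?thesis using that v by blast
qed

section \<open>Rank-one operators\<close>

lemma outer_carrier[simp]: "v \<in> carrier_vec n \<Longrightarrow> w \<in> carrier_vec m \<Longrightarrow> outer v w \<in> carrier_mat n m"
  by (auto simp: outer_def)

lemma mult_outer:
  assumes "A \<in> carrier_mat n m" "v \<in> carrier_vec m"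
  shows "A * outer v w = outer (A *\<^sub>v v) w"
proof (rule eq_matI)
  fix i j assume ij: "i < dim_row (outer (A *\<^sub>v v) w)" "j < dim_col (outer (A *\<^sub>v v) w)"
  then have i: "i < n" and j: "j < dim_vec w" using assms by (auto simp: outer_def)
  have "(A * outer v w) $$ (i,j) = (\<Sum>k<m. A $$ (i,k) * (v $ k * cnj (w $ j)))"
    using i j assms by (auto simp: outer_def scalar_prod_def atLeast0LessThan intro!: sum.cong)
  also have "\<dots> = (A *\<^sub>v v) $ i * cnj (w $ j)"
    by (simp add: mult_mat_vec_index[OF assms i] sum_distrib_right mult.assoc)
  finally show "(A * outer v w) $$ (i,j) = outer (A *\<^sub>v v) w $$ (i,j)"
    using i j assms by (simp add: outer_def)
qed (use assms in \<open>auto simp: outer_def\<close>)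

lemma outer_mult_adj:
  assumes "A \<in> carrier_mat n m" "w \<in> carrier_vec m"
  shows "outer v w * adj A = outer v (A *\<^sub>v w)"
proof (rule eq_matI)
  fix i j assume ij: "i < dim_row (outer v (A *\<^sub>v w))" "j < dim_col (outer v (A *\<^sub>v w))"
  then have i: "i < dim_vec v" and j: "j < n" using assms by (auto simp: outer_def)
  have "(outer v w * adj A) $$ (i,j) = (\<Sum>k<m. (v $ i * cnj (w $ k)) * cnj (A $$ (j,k)))"
    using i j assms by (auto simp: outer_def adj_def scalar_prod_def atLeast0LessThan intro!: sum.cong)
  also have "\<dots> = v $ i * cnj ((A *\<^sub>v w) $ j)"
    by (simp add: mult_mat_vec_index[OF assms j] sum_distrib_left mult_ac)
  finally show "(outer v w * adj A) $$ (i,j) = outer v (A *\<^sub>v w) $$ (i,j)"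
    using i j assms by (simp add: outer_def)
qed (use assms in \<open>auto simp: outer_def adj_def\<close>)

lemma conjugate_outer:
  assumes "A \<in> carrier_mat n m" "v \<in> carrier_vec m" "w \<in> carrier_vec m"
  shows "A * outer v w * adj A = outer (A *\<^sub>v v) (A *\<^sub>v w)"
  by (simp add: mult_outer[OF assms(1,2)] outer_mult_adj[OF assms(1,3)])

lemma mtrace_mult_outer:
  assumes "A \<in> carrier_mat n n" "v \<in> carrier_vec n" "w \<in> carrier_vec n"
  shows "mtrace (A * outer v w) = cinner w (A *\<^sub>v v)"
  using assms unfolding mult_outer[OF assms(1,2)]
  by (auto simp: mtrace_def outer_def cinner_def mult.commute)

section \<open>Verification operators\<close>

definition prod_vec :: "lmeas \<Rightarrow> nat \<times> nat \<Rightarrow> complex vec" where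
  "prod_vec M s = kronv2 (basis_vec (fst M) (fst s)) (basis_vec (snd M) (snd s))"

lemma kronv2_carrier[simp]: "kronv2 a b \<in> carrier_vec 4" "dim_vec (kronv2 a b) = 4"
  by (simp_all add: kronv2_def)

lemma prod_vec_carrier[simp]: "prod_vec M s \<in> carrier_vec 4" "dim_vec (prod_vec M s) = 4"
  by (simp_all add: prod_vec_def)

lemma sum_lessThan_4: "(\<Sum>i<4::nat. f i) = f 0 + f 1 + f 2 + (f 3 :: 'a :: comm_monoid_add)"
  by (simp add: eval_nat_numeral add.assoc)

lemma sum_lessThan_2: "(\<Sum>i<2::nat. f i) = f 0 + (f 1 :: 'a :: comm_monoid_add)"
  by (simp add: eval_nat_numeral)

lemma cinner_kronv2:
  assumes "dim_vec a = 2" "dim_vec b = 2"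
  shows "cinner (kronv2 a b) (kronv2 c d) = cinner a c * cinner b d"
  using assms by (simp add: cinner_def kronv2_def sum_lessThan_4 sum_lessThan_2 algebra_simps)

lemma prod_vec_orthonormal:
  assumes "local_meas M" "s \<in> {0,1} \<times> {0,1}" "t \<in> {0,1} \<times> {0,1}"
  shows "cinner (prod_vec M s) (prod_vec M t) = (if s = t then 1 else 0)"
  using assms
  by (auto simp: prod_vec_def local_meas_def onb2_def unit_state_def basis_vec_def cinner_kronv2
      cinner_commute[of "snd _" "fst _"])

lemma test_op_carrier[simp]:
  "test_op M S \<in> carrier_mat 4 4" "dim_row (test_op M S) = 4" "dim_col (test_op M S) = 4"
  by (simp_all add: test_op_def)

lemma test_op_mult_vec:
  assumes w: "w \<in> carrier_vec 4" and i: "i < 4"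
  shows "(test_op M S *\<^sub>v w) $ i = (\<Sum>s\<in>S. prod_vec M s $ i * cinner (prod_vec M s) w)"
proof -
  have "(test_op M S *\<^sub>v w) $ i =
      (\<Sum>j<4. (\<Sum>s\<in>S. prod_vec M s $ i * cnj (prod_vec M s $ j)) * w $ j)"
    using i by (subst mult_mat_vec_index[OF test_op_carrier(1) w i])
      (auto simp: test_op_def prod_vec_def outer_def case_prod_unfold intro!: sum.cong)
  also have "\<dots> = (\<Sum>s\<in>S. prod_vec M s $ i * (\<Sum>j<4. cnj (prod_vec M s $ j) * w $ j))"
    unfolding sum_distrib_left sum_distrib_right by (subst sum.swap) (simp add: mult.assoc)
  finally show ?thesis by (simp add: cinner_def)
qed

lemma cinner_test_op:
  assumes w: "w \<in> carrier_vec 4" and u: "u \<in> carrier_vec 4"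
  shows "cinner u (test_op M S *\<^sub>v w) = (\<Sum>s\<in>S. cinner u (prod_vec M s) * cinner (prod_vec M s) w)"
proof -
  have "cinner u (test_op M S *\<^sub>v w) =
      (\<Sum>i<4. cnj (u $ i) * (\<Sum>s\<in>S. prod_vec M s $ i * cinner (prod_vec M s) w))"
    using u by (simp add: cinner_def[of u] test_op_mult_vec[OF w] del: index_mult_mat_vec)
  also have "\<dots> = (\<Sum>s\<in>S. (\<Sum>i<4. cnj (u $ i) * prod_vec M s $ i) * cinner (prod_vec M s) w)"
    unfolding sum_distrib_left sum_distrib_right by (subst sum.swap) (simp add: mult.assoc)
  finally show ?thesis using u by (simp add: cinner_def[of u])
qed

text \<open>The vectors \<open>prod_vec M s\<close> form an orthonormal product basis, and
  \<open>test_op M S\<close> is the orthogonal projector onto those with \<open>s\<close> in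
  \<open>S\<close>. A rejected outcome therefore has amplitude zero in any vector that the test
  fixes.\<close>

lemma cinner_prod_vec_test_op:
  assumes "local_meas M" "S \<subseteq> {0,1} \<times> {0,1}" "s \<in> {0,1} \<times> {0,1}" "w \<in> carrier_vec 4"
  shows "cinner (prod_vec M s) (test_op M S *\<^sub>v w) = (if s \<in> S then cinner (prod_vec M s) w else 0)"
proof -
  have fin: "finite S" using assms(2) by (rule finite_subset) simp
  have "cinner (prod_vec M s) (test_op M S *\<^sub>v w) =
      (\<Sum>t\<in>S. if s = t then cinner (prod_vec M t) w else 0)"
    unfolding cinner_test_op[OF assms(4) prod_vec_carrier(1)]
  proof (intro sum.cong refl)
    fix t assume "t \<in> S"
    then show "cinner (prod_vec M s) (prod_vec M t) * cinner (prod_vec M t) w =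
        (if s = t then cinner (prod_vec M t) w else 0)"
      using prod_vec_orthonormal[OF assms(1,3), of t] assms(2) by auto
  qed
  then show ?thesis using fin by simp
qed

lemma test_op_mult_carrier[simp]:
  "test_op M S *\<^sub>v w \<in> carrier_vec 4" "dim_vec (test_op M S *\<^sub>v w) = 4"
  by (simp_all add: carrier_vecI)

lemma test_op_prod_vec:
  assumes "local_meas M" "S \<subseteq> {0,1} \<times> {0,1}" "s \<in> S"
  shows "test_op M S *\<^sub>v prod_vec M s = prod_vec M s"
proof (rule eq_vecI)
  have fin: "finite S" using assms(2) by (rule finite_subset) simp
  fix i assume "i < dim_vec (prod_vec M s)"
  then have i: "i < 4" by simp
  have "(test_op M S *\<^sub>v prod_vec M s) $ i = (\<Sum>t\<in>S. if s = t then prod_vec M s $ i else 0)"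
    unfolding test_op_mult_vec[OF prod_vec_carrier(1) i]
  proof (intro sum.cong refl)
    fix t assume "t \<in> S"
    then show "prod_vec M t $ i * cinner (prod_vec M t) (prod_vec M s) =
        (if s = t then prod_vec M s $ i else 0)"
      using prod_vec_orthonormal[OF assms(1), of t s] subsetD[OF assms(2)] assms(3) by simp
  qed
  then show "(test_op M S *\<^sub>v prod_vec M s) $ i = prod_vec M s $ i" using fin assms by simp
qed simp

text \<open>For a projector, the probability of rejection is the squared length of the rejected
  component. A vector that passes with certainty is thus fixed by the test.\<close>

lemma cinner_test_op_self:
  assumes "local_meas M" "S \<subseteq> {0,1} \<times> {0,1}" "w \<in> carrier_vec 4"
  shows "cinner w w - cinner w (test_op M S *\<^sub>v w) =
    cinner (w - test_op M S *\<^sub>v w) (w - test_op M S *\<^sub>v w)"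
proof -
  let ?T = "test_op M S *\<^sub>v w"
  have "cinner ?T ?T = (\<Sum>s\<in>S. cinner ?T (prod_vec M s) * cinner (prod_vec M s) w)"
    by (rule cinner_test_op[OF assms(3) test_op_mult_carrier(1)])
  also have "\<dots> = (\<Sum>s\<in>S. cinner w (prod_vec M s) * cinner (prod_vec M s) w)"
  proof (intro sum.cong refl)
    fix s assume s: "s \<in> S"
    have "cinner ?T (prod_vec M s) = cnj (cinner (prod_vec M s) ?T)"
      by (rule cinner_commute) simp
    also have "\<dots> = cnj (cinner (prod_vec M s) w)"
      using cinner_prod_vec_test_op[OF assms(1,2) _ assms(3), of s] assms(2) s by auto
    also have "\<dots> = cinner w (prod_vec M s)"
      using assms(3) by (intro cinner_commute[symmetric]) simp
    finally show "cinner ?T (prod_vec M s) * cinner (prod_vec M s) w =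
      cinner w (prod_vec M s) * cinner (prod_vec M s) w" by simp
  qed
  also have "\<dots> = cinner w ?T"
    by (rule cinner_test_op[OF assms(3,3), symmetric])
  finally have TT: "cinner ?T ?T = cinner w ?T" .
  \<comment> \<open>\<open>cinner w ?T\<close> equals a squared length, hence is real, so the order
    of the two arguments does not matter.\<close>
  have "cinner ?T w = cnj (cinner w ?T)"
    using assms by (intro cinner_commute) simp
  also have "\<dots> = cinner w ?T"
    using Re_cinner_self(1)[of ?T] unfolding TT by (metis complex_cnj_complex_of_real)
  finally show ?thesis
    using assms TT by (simp add: cinner_diff_left cinner_diff_right)
qed

section \<open>Mixtures of tests and their fixed vectors\<close>

text \<open>The flattened list forgets how tests are grouped into settings. The verification
  operator is a weighted sum over this list; the grouping matters only for counting
  settings.\<close>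

definition tests :: "state_protocol \<Rightarrow> (lmeas \<times> (nat \<times> nat) set \<times> real) list" where
  "tests sp = concat (map (\<lambda>(M,ts). map (\<lambda>(S,p). (M,S,p)) ts) sp)"

lemma total_prob_tests: "total_prob sp = sum_list (map (\<lambda>(M,S,p). p) (tests sp))"
  by (induction sp)
    (auto simp: total_prob_def tests_def comp_def case_prod_unfold)

lemma ver_op_carrier[simp]:
  "ver_op sp \<in> carrier_mat 4 4" "dim_row (ver_op sp) = 4" "dim_col (ver_op sp) = 4"
  by (simp_all add: ver_op_def)

lemma ver_op_mult_carrier[simp]:
  "ver_op sp *\<^sub>v w \<in> carrier_vec 4" "dim_vec (ver_op sp *\<^sub>v w) = 4"
  by (simp_all add: carrier_vecI)

lemma sum_sum_list: "(\<Sum>i\<in>I. sum_list (map (f i) xs)) = sum_list (map (\<lambda>x. \<Sum>i\<in>I. f i x) xs)"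
  for f :: "_ \<Rightarrow> _ \<Rightarrow> 'a :: comm_monoid_add"
  by (induction xs) (auto simp: sum.distrib)

lemma ver_op_index:
  assumes "i < 4" "j < 4"
  shows "ver_op sp $$ (i,j) = sum_list (map (\<lambda>(M,S,p). of_real p * test_op M S $$ (i,j)) (tests sp))"
  using assms
  by (induction sp)
    (auto simp: ver_op_def tests_def comp_def case_prod_unfold)

lemma ver_op_mult_vec:
  assumes w: "w \<in> carrier_vec 4" and i: "i < 4"
  shows "(ver_op sp *\<^sub>v w) $ i =
    sum_list (map (\<lambda>(M,S,p). of_real p * (test_op M S *\<^sub>v w) $ i) (tests sp))"
  unfolding mult_mat_vec_index[OF ver_op_carrier(1) w i] mult_mat_vec_index[OF test_op_carrier(1) w i]
  by (simp add: ver_op_index[OF i] sum_list_mult_const[symmetric] case_prod_unfold sum_sum_list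
      sum_distrib_left mult.assoc)

lemma cinner_ver_op:
  assumes w: "w \<in> carrier_vec 4" and u: "u \<in> carrier_vec 4"
  shows "cinner u (ver_op sp *\<^sub>v w) =
    sum_list (map (\<lambda>(M,S,p). of_real p * cinner u (test_op M S *\<^sub>v w)) (tests sp))"
  using u unfolding cinner_def
  by (simp add: ver_op_mult_vec[OF w] sum_list_const_mult[symmetric] case_prod_unfold sum_sum_list
      sum_distrib_left algebra_simps del: index_mult_mat_vec)

lemma in_tests_iff: "(M,S,p) \<in> set (tests sp) \<longleftrightarrow> (\<exists>ts. (M,ts) \<in> set sp \<and> (S,p) \<in> set ts)"
proof
  assume "(M,S,p) \<in> set (tests sp)"
  then show "\<exists>ts. (M,ts) \<in> set sp \<and> (S,p) \<in> set ts" by (auto simp: tests_def)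
next
  assume "\<exists>ts. (M,ts) \<in> set sp \<and> (S,p) \<in> set ts"
  then obtain ts where ts: "(M,ts) \<in> set sp" "(S,p) \<in> set ts" by blast
  then have "(M,S,p) \<in> set ((\<lambda>(M,ts). map (\<lambda>(S,p). (M,S,p)) ts) (M,ts))"
    by (auto intro!: image_eqI[of _ _ "(S,p)"])
  then show "(M,S,p) \<in> set (tests sp)"
    using ts(1) unfolding tests_def set_concat set_map by blast
qed

lemma ball_case_prod: "(\<forall>(x,y)\<in>A. P x y) \<longleftrightarrow> (\<forall>x y. (x,y) \<in> A \<longrightarrow> P x y)"
  by auto

lemma ball_tests:
  "(\<forall>(M,S,p)\<in>set (tests sp). Q M S p) \<longleftrightarrow> (\<forall>(M,ts)\<in>set sp. \<forall>(S,p)\<in>set ts. Q M S p)"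
  unfolding ball_case_prod split_paired_All case_prod_conv in_tests_iff by blast

text \<open>The first conjunct accounts for settings with an empty list of tests, which leave no
  trace in \<open>tests sp\<close>.\<close>

lemma valid_state_protocol_tests:
  "valid_state_protocol \<phi> sp \<longleftrightarrow> (\<forall>(M,ts)\<in>set sp. local_meas M) \<and>
    (\<forall>(M,S,p)\<in>set (tests sp). local_meas M \<and> S \<subseteq> {0,1} \<times> {0,1} \<and> 0 \<le> p \<and> test_op M S *\<^sub>v \<phi> = \<phi>) \<and>
    sum_list (map (\<lambda>(M,S,p). p) (tests sp)) = 1"
  unfolding valid_state_protocol_def total_prob_tests ball_tests
  unfolding ball_case_prod by meson

lemma sum_list_of_real_mult:
  "sum_list (map (\<lambda>(M,S,p). of_real p * c) ts) = of_real (sum_list (map (\<lambda>(M,S,p). p) ts)) * (c :: complex)"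
  by (induction ts) (auto simp: algebra_simps)

lemma ver_op_fixed:
  assumes tot: "sum_list (map (\<lambda>(M,S,p). p) (tests sp)) = 1" and w: "w \<in> carrier_vec 4"
    and fixed: "\<forall>(M,S,p)\<in>set (tests sp). p = 0 \<or> test_op M S *\<^sub>v w = w"
  shows "ver_op sp *\<^sub>v w = w"
proof (rule eq_vecI)
  fix i assume "i < dim_vec w"
  then have i: "i < 4" using w by simp
  have "(ver_op sp *\<^sub>v w) $ i = sum_list (map (\<lambda>(M,S,p). of_real p * w $ i) (tests sp))"
    unfolding ver_op_mult_vec[OF w i] using fixed
    by (intro arg_cong[where f = sum_list] map_cong) auto
  also have "\<dots> = of_real (sum_list (map (\<lambda>(M,S,p). p) (tests sp))) * w $ i"
    by (rule sum_list_of_real_mult)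
  finally show "(ver_op sp *\<^sub>v w) $ i = w $ i" using tot by simp
qed (use w in simp)

text \<open>The difference of the two sides is the sum of the squared lengths of the rejected
  components, weighted by the probabilities. Every term is nonnegative, so equality makes each term
  vanish.\<close>

lemma
  assumes val: "valid_state_protocol \<phi> sp" and w: "w \<in> carrier_vec 4"
  shows Re_cinner_ver_op_le: "Re (cinner w (ver_op sp *\<^sub>v w)) \<le> Re (cinner w w)"
    and Re_cinner_ver_op_eq: "Re (cinner w (ver_op sp *\<^sub>v w)) = Re (cinner w w) \<Longrightarrow>
      (M,S,p) \<in> set (tests sp) \<Longrightarrow> p = 0 \<or> test_op M S *\<^sub>v w = w"
proof -
  note v = val[unfolded valid_state_protocol_tests]
  define g where "g = (\<lambda>(M,S,p). p * Re (cinner (w - test_op M S *\<^sub>v w) (w - test_op M S *\<^sub>v w)))"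
  have g0: "0 \<le> g t" if "t \<in> set (tests sp)" for t
    using v that Re_cinner_self(2) by (force simp: g_def)
  have sum_eq: "sum_list (map (\<lambda>(M,S,p). p * a - p * Re (f M S)) ts) =
      sum_list (map (\<lambda>(M,S,p). p) ts) * a - Re (sum_list (map (\<lambda>(M,S,p). of_real p * f M S) ts))"
    for a f and ts :: "(lmeas \<times> (nat \<times> nat) set \<times> real) list"
    by (induction ts) (auto simp: algebra_simps)
  have "sum_list (map g (tests sp)) = sum_list (map (\<lambda>(M,S,p). p * Re (cinner w w) -
      p * Re (cinner w (test_op M S *\<^sub>v w))) (tests sp))"
    using v w by (intro arg_cong[where f = sum_list] map_cong)
      (auto simp: g_def cinner_test_op_self[symmetric] algebra_simps)
  also have "\<dots> = sum_list (map (\<lambda>(M,S,p). p) (tests sp)) * Re (cinner w w) -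
      Re (sum_list (map (\<lambda>(M,S,p). of_real p * cinner w (test_op M S *\<^sub>v w)) (tests sp)))"
    by (rule sum_eq)
  finally have eq: "sum_list (map g (tests sp)) = Re (cinner w w) - Re (cinner w (ver_op sp *\<^sub>v w))"
    using v w by (simp add: cinner_ver_op)
  have "0 \<le> sum_list (map g (tests sp))"
    using g0 by (intro sum_list_nonneg) auto
  then show "Re (cinner w (ver_op sp *\<^sub>v w)) \<le> Re (cinner w w)"
    using eq by simp
  assume "Re (cinner w (ver_op sp *\<^sub>v w)) = Re (cinner w w)" and t: "(M,S,p) \<in> set (tests sp)"
  then have "sum_list (map g (tests sp)) = 0" using eq by simp
  then have "\<forall>x\<in>set (map g (tests sp)). x = 0"
    using g0 by (subst (asm) sum_list_nonneg_eq_0_iff) auto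
  then have "g (M,S,p) = 0" using t by auto
  then consider "p = 0" | "Re (cinner (w - test_op M S *\<^sub>v w) (w - test_op M S *\<^sub>v w)) = 0"
    by (auto simp: g_def)
  then show "p = 0 \<or> test_op M S *\<^sub>v w = w"
  proof cases
    case 2
    then have "w - test_op M S *\<^sub>v w = 0\<^sub>v 4"
      using w cinner_self_eq_0[of "w - test_op M S *\<^sub>v w"]
        Re_cinner_self(1)[of "w - test_op M S *\<^sub>v w"] by simp
    then have "\<forall>i<4. (w - test_op M S *\<^sub>v w) $ i = 0" by simp
    then have "test_op M S *\<^sub>v w = w"
      using w by (intro eq_vecI) auto
    then show ?thesis ..
  qed simp
qed

text \<open>This replaces the eigenvalue condition on the mixture by a condition on the joint fixed
  vectors of the individual tests, the form in which gaps are both established and exploited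
  below.\<close>

lemma positive_gap_iff:
  assumes val: "valid_state_protocol \<phi> sp"
  shows "positive_gap \<phi> sp \<longleftrightarrow> (\<forall>w\<in>carrier_vec 4.
    (\<forall>(M,S,p)\<in>set (tests sp). p = 0 \<or> test_op M S *\<^sub>v w = w) \<longrightarrow> (\<exists>c. w = c \<cdot>\<^sub>v \<phi>))"
proof -
  have "ver_op sp *\<^sub>v w = w \<longleftrightarrow> (\<forall>(M,S,p)\<in>set (tests sp). p = 0 \<or> test_op M S *\<^sub>v w = w)"
    if w: "w \<in> carrier_vec 4" for w
  proof
    assume "ver_op sp *\<^sub>v w = w"
    then show "\<forall>(M,S,p)\<in>set (tests sp). p = 0 \<or> test_op M S *\<^sub>v w = w"
      using Re_cinner_ver_op_eq[OF val w] unfolding ball_case_prod split_paired_All case_prod_conv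
      by metis
  next
    assume "\<forall>(M,S,p)\<in>set (tests sp). p = 0 \<or> test_op M S *\<^sub>v w = w"
    then show "ver_op sp *\<^sub>v w = w"
      using ver_op_fixed[OF _ w] val unfolding valid_state_protocol_tests by blast
  qed
  then show ?thesis unfolding positive_gap_def by blast
qed

section \<open>Channels fixing the test states\<close>

lemma foldr_carrier:
  assumes "\<forall>K\<in>set Ks. f K \<in> carrier_mat n m"
  shows "foldr (\<lambda>K acc. f K + acc) Ks (0\<^sub>m n m) \<in> carrier_mat n m"
  using assms by (induction Ks) auto

text \<open>Trace preservation in polarised form: summed over the Kraus operators, all inner
  products are preserved. The case of two different test states is what links their
  coefficients.\<close>

lemma kraus_cinner:
  assumes "kraus Ks" "v \<in> carrier_vec 4" "w \<in> carrier_vec 4"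
  shows "sum_list (map (\<lambda>K. cinner (K *\<^sub>v v) (K *\<^sub>v w)) Ks) = cinner v w"
proof -
  \<comment> \<open>The induction runs over arbitrary lists of matrices, because the tail of a Kraus
    family no longer sums to the identity.\<close>
  have "cinner v (foldr (\<lambda>K acc. adj K * K + acc) Ks (0\<^sub>m 4 4) *\<^sub>v w) =
      sum_list (map (\<lambda>K. cinner (K *\<^sub>v v) (K *\<^sub>v w)) Ks)"
    if "\<forall>K\<in>set Ks. K \<in> carrier_mat 4 4" for Ks
    using that
  proof (induction Ks)
    case Nil
    then show ?case using assms by (simp add: cinner_def)
  next
    case (Cons K Ks)
    let ?F = "foldr (\<lambda>K acc. adj K * K + acc) Ks (0\<^sub>m 4 4)"
    have K: "K \<in> carrier_mat 4 4" and KK: "adj K * K \<in> carrier_mat 4 4"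
      using Cons.prems by (auto intro!: mult_carrier_mat[of _ 4 4])
    have F: "?F \<in> carrier_mat 4 4"
      using Cons.prems by (intro foldr_carrier) (auto intro!: mult_carrier_mat[of _ 4 4])
    have "cinner v ((adj K * K + ?F) *\<^sub>v w) = cinner v ((adj K * K) *\<^sub>v w) + cinner v (?F *\<^sub>v w)"
      unfolding add_mult_distrib_mat_vec[OF KK F assms(3)]
      using assms(2) carrier_matD[OF KK] carrier_matD[OF F]
      by (intro cinner_add_right) auto
    then show ?case
      using Cons cinner_adj_mult[OF K assms(2,3)] by simp
  qed
  from this[of Ks] show ?thesis
    using assms by (simp add: kraus_def)
qed

lemma channel_carrier:
  assumes "\<forall>K\<in>set Ks. K \<in> carrier_mat 4 m" "\<rho> \<in> carrier_mat m m"
  shows "channel Ks \<rho> \<in> carrier_mat 4 4"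
  using assms unfolding channel_def by (intro foldr_carrier) (auto intro!: mult_carrier_mat)

lemma mtrace_mult_add:
  assumes "A \<in> carrier_mat n n" "B \<in> carrier_mat n n" "C \<in> carrier_mat n n"
  shows "mtrace (A * (B + C)) = mtrace (A * B) + mtrace (A * C)"
  using assms by (simp add: mult_add_distrib_mat[OF assms] mtrace_def sum.distrib)

lemma mtrace_mult_channel:
  assumes "A \<in> carrier_mat 4 4" "v \<in> carrier_vec 4" "\<forall>K\<in>set Ks. K \<in> carrier_mat 4 4"
  shows "mtrace (A * channel Ks (outer v v)) =
    sum_list (map (\<lambda>K. cinner (K *\<^sub>v v) (A *\<^sub>v (K *\<^sub>v v))) Ks)"
  using assms(3)
proof (induction Ks)
  case Nil
  have "A * 0\<^sub>m 4 4 = 0\<^sub>m 4 4" using assms(1) by (rule right_mult_zero_mat)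
  then show ?case by (simp add: channel_def mtrace_def)
next
  case (Cons K Ks)
  then have K: "K \<in> carrier_mat 4 4" by simp
  have Kv: "K *\<^sub>v v \<in> carrier_vec 4" using K assms(2) by (rule mult_mat_vec_carrier)
  have "channel (K # Ks) (outer v v) = outer (K *\<^sub>v v) (K *\<^sub>v v) + channel Ks (outer v v)"
    by (simp add: channel_def conjugate_outer[OF K assms(2,2)])
  moreover have "channel Ks (outer v v) \<in> carrier_mat 4 4"
    using Cons.prems assms by (intro channel_carrier[of _ 4]) auto
  ultimately show ?case
    using Cons by (simp add: mtrace_mult_add[OF assms(1) outer_carrier[OF Kv Kv]]
      mtrace_mult_outer[OF assms(1) Kv Kv])
qed

text \<open>Scalars enter only through their squared moduli. In \<open>verifiesI\<close> the total
  weight turns out to be 1, so the channel is conjugation by \<open>U\<close>.\<close>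

lemma channel_scalar:
  assumes "U \<in> carrier_mat 4 4" "\<rho> \<in> carrier_mat 4 4" "\<forall>K\<in>set Ks. K = c K \<cdot>\<^sub>m U"
  shows "channel Ks \<rho> = sum_list (map (\<lambda>K. cnj (c K) * c K) Ks) \<cdot>\<^sub>m (U * \<rho> * adj U)"
  using assms(3)
proof (induction Ks)
  case Nil
  have "U * \<rho> * adj U \<in> carrier_mat 4 4"
    using assms by (intro mult_carrier_mat adj_carrier)
  then show ?case
    using carrier_matD[of "U * \<rho> * adj U" 4 4]
    by (intro eq_matI) (auto simp: channel_def simp del: index_mult_mat)
next
  case (Cons K Ks)
  have K: "K = c K \<cdot>\<^sub>m U" using Cons.prems by simp
  have adj: "adj (d \<cdot>\<^sub>m U) = cnj d \<cdot>\<^sub>m adj U" for d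
    by (intro eq_matI) (auto simp: adj_def)
  have U\<rho>: "U * \<rho> \<in> carrier_mat 4 4" and aU: "adj U \<in> carrier_mat 4 4"
    using assms by (auto intro: mult_carrier_mat)
  have c: "U * \<rho> * adj U \<in> carrier_mat 4 4" using U\<rho> aU by (rule mult_carrier_mat)
  have "(d \<cdot>\<^sub>m U) * \<rho> * adj (d \<cdot>\<^sub>m U) = (cnj d * d) \<cdot>\<^sub>m (U * \<rho> * adj U)" for d
    unfolding adj mult_smult_assoc_mat[OF assms(1,2)] mult_smult_assoc_mat[OF U\<rho> smult_carrier_mat[OF aU]]
      mult_smult_distrib[OF U\<rho> aU] using c by (intro eq_matI) auto
  then have "K * \<rho> * adj K = (cnj (c K) * c K) \<cdot>\<^sub>m (U * \<rho> * adj U)"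
    using K by metis
  then show ?case
    using Cons c by (simp add: channel_def add_smult_distrib_right_mat[OF c])
qed

lemma unit_kronv2:
  assumes "unit_state 2 a" "unit_state 2 b"
  shows "cinner (kronv2 a b) (kronv2 a b) = 1"
  using assms by (simp add: unit_state_def cinner_kronv2)

text \<open>The pass probability is \<open>\<Sum>\<^sub>K \<langle>K\<psi>|\<Omega>|K\<psi>\<rangle> \<le> \<Sum>\<^sub>K \<langle>K\<psi>|K\<psi>\<rangle> = 1\<close>; equality holds term by term.\<close>

lemma passing_kraus_output:
  assumes val: "valid_state_protocol \<phi> sp" and gap: "positive_gap \<phi> sp"
    and kr: "kraus Ks" and K: "K \<in> set Ks" and v: "v \<in> carrier_vec 4" "cinner v v = 1"
    and pass: "mtrace (ver_op sp * channel Ks (outer v v)) = 1"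
  shows "\<exists>c. K *\<^sub>v v = c \<cdot>\<^sub>v \<phi>"
proof -
  have car: "\<forall>K\<in>set Ks. K \<in> carrier_mat 4 4" using kr by (simp add: kraus_def)
  then have Kv: "K *\<^sub>v v \<in> carrier_vec 4" if "K \<in> set Ks" for K
    using that v(1) by (intro mult_mat_vec_carrier) auto
  define g where "g K = Re (cinner (K *\<^sub>v v) (K *\<^sub>v v)) -
    Re (cinner (K *\<^sub>v v) (ver_op sp *\<^sub>v (K *\<^sub>v v)))" for K
  have split: "sum_list (map (\<lambda>K. Re (f K) - Re (h K)) Ks) =
      Re (sum_list (map f Ks)) - Re (sum_list (map h Ks))" for f h :: "complex mat \<Rightarrow> complex" and Ks
    by (induction Ks) auto
  have "sum_list (map g Ks) = 0"
    using kraus_cinner[OF kr v(1,1)] mtrace_mult_channel[OF ver_op_carrier(1) v(1) car, of sp] v(2) pass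
    unfolding g_def split by simp
  moreover have "0 \<le> g K" if "K \<in> set Ks" for K
    using Re_cinner_ver_op_le[OF val Kv[OF that]] by (simp add: g_def)
  ultimately have "\<forall>x\<in>set (map g Ks). x = 0"
    by (subst (asm) sum_list_nonneg_eq_0_iff) auto
  then have "g K = 0" using K by auto
  then have "\<forall>(M,S,p)\<in>set (tests sp). p = 0 \<or> test_op M S *\<^sub>v (K *\<^sub>v v) = K *\<^sub>v v"
    using Re_cinner_ver_op_eq[OF val Kv[OF K]] unfolding ball_case_prod split_paired_All case_prod_conv g_def
    by (metis eq_iff_diff_eq_0)
  then show ?thesis
    using gap Kv[OF K] unfolding positive_gap_iff[OF val] by blast
qed

text \<open>The equality case of Cauchy-Schwarz: the squared distance of the two families expands to
  1 + 1 - 1 - 1 = 0.\<close>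

lemma sum_list_cong_phase:
  fixes c d :: "'a \<Rightarrow> complex"
  assumes "sum_list (map (\<lambda>k. cnj (c k) * c k) ks) = 1" "sum_list (map (\<lambda>k. cnj (d k) * d k) ks) = 1"
    "sum_list (map (\<lambda>k. cnj (c k) * d k) ks) = 1" "k \<in> set ks"
  shows "c k = d k"
proof -
  have "complex_of_real (sum_list (map (\<lambda>k. (cmod (c k - d k))\<^sup>2) ks)) =
      sum_list (map (\<lambda>k. cnj (c k) * c k) ks) + sum_list (map (\<lambda>k. cnj (d k) * d k) ks) -
      sum_list (map (\<lambda>k. cnj (c k) * d k) ks) - cnj (sum_list (map (\<lambda>k. cnj (c k) * d k) ks))" for ks
    by (induction ks) (auto simp: complex_norm_square algebra_simps simp del: of_real_power)
  then have "complex_of_real (sum_list (map (\<lambda>k. (cmod (c k - d k))\<^sup>2) ks)) = 0"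
    using assms by simp
  then have "sum_list (map (\<lambda>k. (cmod (c k - d k))\<^sup>2) ks) = 0" by (simp only: of_real_eq_0_iff)
  then have "\<forall>x\<in>set (map (\<lambda>k. (cmod (c k - d k))\<^sup>2) ks). x = 0"
    by (subst (asm) sum_list_nonneg_eq_0_iff) auto
  then show ?thesis using assms(4) by auto
qed

text \<open>The hub is a test state that overlaps with every test state; through it all coefficients
  of one Kraus operator are compared. Spanning is phrased by orthogonality because it is applied to
  the rows of \<open>K\<close> minus a multiple of \<open>U\<close>.\<close>

lemma verifiesI:
  assumes U: "U \<in> carrier_mat 4 4" "adj U * U = 1\<^sub>m 4"
    and val: "valid_protocol U P" and ord: "ordinary U P"
    and span: "\<And>w. w \<in> carrier_vec 4 \<Longrightarrow> \<forall>((a,b),sp)\<in>set P. cinner (kronv2 a b) w = 0 \<Longrightarrow> w = 0\<^sub>v 4"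
    and hub: "((a0,b0),sp0) \<in> set P" "\<forall>((a,b),sp)\<in>set P. cinner (kronv2 a0 b0) (kronv2 a b) \<noteq> 0"
  shows "verifies U P"
  unfolding verifies_def
proof (intro conjI allI impI ballI)
  fix Ks and \<rho> :: "complex mat" assume "kraus Ks \<and> passes_all P Ks" and \<rho>: "\<rho> \<in> carrier_mat 4 4"
  then have kr: "kraus Ks" and pass: "passes_all P Ks" by auto
  have car: "K \<in> carrier_mat 4 4" if "K \<in> set Ks" for K using kr that by (simp add: kraus_def)
  define I where "I = {kronv2 a b | a b sp. ((a,b),sp) \<in> set P}"
  have Icar: "v \<in> carrier_vec 4" if "v \<in> I" for v using that by (auto simp: I_def)
  have I1: "cinner v v = 1" if "v \<in> I" for v
    using that val by (auto simp: I_def valid_protocol_def intro!: unit_kronv2)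
  have "\<exists>c. K *\<^sub>v v = c \<cdot>\<^sub>v (U *\<^sub>v v)" if K: "K \<in> set Ks" and "v \<in> I" for K v
  proof -
    obtain a b sp where v: "v = kronv2 a b" and P: "((a,b),sp) \<in> set P"
      using \<open>v \<in> I\<close> by (auto simp: I_def)
    show ?thesis
    proof (rule passing_kraus_output[OF _ _ kr K Icar I1])
      show "valid_state_protocol (U *\<^sub>v v) sp" using val P by (auto simp: valid_protocol_def v)
      show "positive_gap (U *\<^sub>v v) sp" using ord P by (auto simp: ordinary_def v)
      show "mtrace (ver_op sp * channel Ks (outer v v)) = 1" using pass P by (auto simp: passes_all_def v)
    qed (use \<open>v \<in> I\<close> in auto)
  qed
  then obtain c where c: "K *\<^sub>v v = c K v \<cdot>\<^sub>v (U *\<^sub>v v)" if "K \<in> set Ks" "v \<in> I" for K v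
    by metis
  define h where "h = kronv2 a0 b0"
  have h: "h \<in> I" using hub(1) by (auto simp: I_def h_def)
  \<comment> \<open>Since \<open>U\<close> is an isometry, each summand of the preserved inner
    product is a product of coefficients times \<open>cinner v w\<close>, and a nonzero
    \<open>cinner v w\<close> can be cancelled.\<close>
  have gram: "sum_list (map (\<lambda>K. cnj (c K v) * c K w) Ks) = 1"
    if v: "v \<in> I" and w: "w \<in> I" and "cinner v w \<noteq> 0" for v w
  proof -
    have Uvw: "U *\<^sub>v v \<in> carrier_vec 4" "U *\<^sub>v w \<in> carrier_vec 4"
      using Icar[OF v] Icar[OF w] U by (auto intro!: mult_mat_vec_carrier)
    have "cinner (K *\<^sub>v v) (K *\<^sub>v w) = (cnj (c K v) * c K w) * cinner v w" if "K \<in> set Ks" for K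
      unfolding c[OF that v] c[OF that w] cinner_smult_left
      using Uvw by (subst cinner_smult_right)
        (auto simp: isometry_cinner[OF U Icar[OF v] Icar[OF w]] carrier_vecD)
    then have "sum_list (map (\<lambda>K. cinner (K *\<^sub>v v) (K *\<^sub>v w)) Ks) =
        sum_list (map (\<lambda>K. (cnj (c K v) * c K w) * cinner v w) Ks)"
      by (intro arg_cong[where f = sum_list] map_cong) auto
    then show ?thesis
      using kraus_cinner[OF kr Icar[OF v] Icar[OF w]] \<open>cinner v w \<noteq> 0\<close>
      by (simp add: sum_list_mult_const)
  qed
  have hv: "c K v = c K h" if K: "K \<in> set Ks" and v: "v \<in> I" for K v
  proof (rule sum_list_cong_phase[where c = "\<lambda>K. c K h" and d = "\<lambda>K. c K v", symmetric, OF _ _ _ K])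
    have "cinner h v \<noteq> 0" using v hub(2) by (auto simp: I_def h_def)
    then show "sum_list (map (\<lambda>K. cnj (c K h) * c K v) Ks) = 1" by (rule gram[OF h v])
  qed (use gram[OF h h] gram[OF v v] I1[OF h] I1[OF v] in auto)
  have "K = c K h \<cdot>\<^sub>m U" if K: "K \<in> set Ks" for K
  proof (rule eq_matI)
    fix i j assume "i < dim_row (c K h \<cdot>\<^sub>m U)" "j < dim_col (c K h \<cdot>\<^sub>m U)"
    then have ij: "i < 4" "j < 4" using U by auto
    \<comment> \<open>The conjugated row \<open>i\<close> of the difference: its inner product with
      a test state \<open>v\<close> is the conjugate of entry \<open>i\<close> of the difference
      applied to \<open>v\<close>.\<close>
    define r where "r = vec 4 (\<lambda>j. cnj (K $$ (i,j) - c K h * U $$ (i,j)))"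
    have r: "r \<in> carrier_vec 4" by (simp add: r_def)
    have "r = 0\<^sub>v 4"
    proof (rule span[OF r])
      have "cinner v r = 0" if v: "v \<in> I" for v
      proof -
        have "(K *\<^sub>v v) $ i = c K h * (U *\<^sub>v v) $ i"
          using c[OF K v] hv[OF K v] ij U by simp
        then have "(\<Sum>j<4. K $$ (i,j) * v $ j) = c K h * (\<Sum>j<4. U $$ (i,j) * v $ j)"
          by (simp only: mult_mat_vec_index[OF car[OF K] Icar[OF v] ij(1)]
              mult_mat_vec_index[OF U(1) Icar[OF v] ij(1)])
        then have "cnj (\<Sum>j<4. (K $$ (i,j) - c K h * U $$ (i,j)) * v $ j) = 0"
          by (simp add: left_diff_distrib sum_subtractf sum_distrib_left mult.assoc)
        then show ?thesis
          using Icar[OF v] by (simp add: cinner_def r_def mult.commute)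
      qed
      then show "\<forall>((a,b),sp)\<in>set P. cinner (kronv2 a b) r = 0"
        by (auto simp: I_def)
    qed
    then have "r $ j = 0" using ij by simp
    then have "K $$ (i,j) - c K h * U $$ (i,j) = 0"
      using ij by (simp add: r_def del: complex_cnj_diff)
    then show "K $$ (i,j) = (c K h \<cdot>\<^sub>m U) $$ (i,j)"
      using ij U by simp
  qed (use car[OF K] U in auto)
  then have "channel Ks \<rho> = sum_list (map (\<lambda>K. cnj (c K h) * c K h) Ks) \<cdot>\<^sub>m (U * \<rho> * adj U)"
    by (intro channel_scalar[OF U(1) \<rho>]) auto
  also have "\<dots> = U * \<rho> * adj U"
    using gram[OF h h] I1[OF h] U(1) by (auto intro!: eq_matI)
  finally show "channel Ks \<rho> = U * \<rho> * adj U" .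
qed (rule val)

text \<open>Otherwise the reflection \<open>1 - 2|w\<rangle>\<langle>w|\<close> followed by \<open>U\<close> passes all tests.\<close>

lemma verifies_no_orthogonal:
  assumes U: "U \<in> carrier_mat 4 4" "adj U * U = 1\<^sub>m 4"
    and ver: "verifies U P" and w: "w \<in> carrier_vec 4"
    and orth: "\<forall>((a,b),sp)\<in>set P. cinner (kronv2 a b) w = 0"
  shows "w = 0\<^sub>v 4"
proof (rule ccontr)
  assume w0: "w \<noteq> 0\<^sub>v 4"
  define N where "N = cinner w w"
  have N: "N \<noteq> 0" "cnj N = N"
    using w w0 cinner_self_eq_0[of w] Re_cinner_self(1)[of w]
    unfolding N_def by (auto, metis complex_cnj_complex_of_real)
  \<comment> \<open>The reflection in \<open>w\<close>, divided by \<open>N\<close> because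
    \<open>w\<close> is not normalised.\<close>
  define V where "V = mat 4 4 (\<lambda>(i,j). (if i = j then 1 else 0) - 2 / N * w $ i * cnj (w $ j))"
  have V: "V \<in> carrier_mat 4 4" by (simp add: V_def)
  have Vv: "V *\<^sub>v v = v - (2 / N * cinner w v) \<cdot>\<^sub>v w" if v: "v \<in> carrier_vec 4" for v
  proof (rule eq_vecI)
    fix i assume "i < dim_vec (v - (2 / N * cinner w v) \<cdot>\<^sub>v w)"
    then have i: "i < 4" using w by simp
    have "(V *\<^sub>v v) $ i = (\<Sum>j<4. (if i = j then v $ j else 0) - 2 / N * w $ i * (cnj (w $ j) * v $ j))"
      using i by (subst mult_mat_vec_index[OF V v i])
        (auto simp: V_def algebra_simps intro!: sum.cong)
    also have "\<dots> = v $ i - 2 / N * w $ i * cinner w v"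
      using i w by (simp add: sum_subtractf cinner_def sum_distrib_left)
    finally show "(V *\<^sub>v v) $ i = (v - (2 / N * cinner w v) \<cdot>\<^sub>v w) $ i"
      using i v w by simp
  qed (use V w in auto)
  define K where "K = U * V"
  have K: "K \<in> carrier_mat 4 4" using U V by (auto simp: K_def)
  have Kv: "K *\<^sub>v v = U *\<^sub>v (V *\<^sub>v v)" if "v \<in> carrier_vec 4" for v
    unfolding K_def by (rule assoc_mult_mat_vec[OF U(1) V that])
  have adjV: "adj V = V"
    using N(2) by (intro eq_matI) (auto simp: V_def adj_def)
  have VV: "V * V = 1\<^sub>m 4"
  proof (rule eq_matI)
    fix i j assume "i < dim_row (1\<^sub>m 4 :: complex mat)" "j < dim_col (1\<^sub>m 4 :: complex mat)"
    then have ij: "i < 4" "j < 4" by auto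
    have nw: "(\<Sum>k<4. cnj (w $ k) * w $ k) = N" using w by (simp add: N_def cinner_def)
    have "(V * V) $$ (i,j) = (\<Sum>k<4. ((if i = k then 1 else 0) - 2 / N * w $ i * cnj (w $ k)) *
        ((if k = j then 1 else 0) - 2 / N * w $ k * cnj (w $ j)))"
      using ij by (auto simp: V_def scalar_prod_def atLeast0LessThan intro!: sum.cong)
    also have "\<dots> = (\<Sum>k<4. (if i = k then if k = j then 1 else 0 else 0)
        - (if i = k then 2 / N * w $ k * cnj (w $ j) else 0)
        - (if k = j then 2 / N * w $ i * cnj (w $ k) else 0)
        + 2 / N * w $ i * (2 / N) * cnj (w $ j) * (cnj (w $ k) * w $ k))"
      by (intro sum.cong) (auto simp: algebra_simps)
    also have "\<dots> = (if i = j then 1 else 0) - 2 / N * w $ i * cnj (w $ j) - 2 / N * w $ i * cnj (w $ j)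
        + 2 / N * w $ i * (2 / N) * cnj (w $ j) * N"
      using ij nw
      by (simp add: sum.distrib sum_subtractf sum_distrib_left[symmetric] del: times_divide_eq_left times_divide_eq_right)
    finally show "(V * V) $$ (i,j) = 1\<^sub>m 4 $$ (i,j)"
      using ij N by simp
  qed (simp_all add: V_def)
  have "adj K = V * adj U"
  proof -
    have "adj K = adj V * adj U"
      using U V unfolding K_def
      by (intro eq_matI) (auto simp: adj_def scalar_prod_def mult.commute intro!: sum.cong)
    then show ?thesis using adjV by simp
  qed
  then have "adj K * K = V * (adj U * (U * V))"
    unfolding K_def using assoc_mult_mat[OF V adj_carrier[OF U(1)], of "U * V" 4] U V by simp
  also have "\<dots> = 1\<^sub>m 4"
    using assoc_mult_mat[OF adj_carrier[OF U(1)] U(1) V] U(2) V VV by simp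
  finally have "adj K * K = 1\<^sub>m 4" .
  then have kr: "kraus [K]" using K by (simp add: kraus_def)
  have "passes_all P [K]"
    unfolding passes_all_def
  proof (clarify)
    fix a b sp assume P: "((a,b),sp) \<in> set P"
    let ?v = "kronv2 a b"
    have "cinner w ?v = 0"
      using orth P w cinner_commute[of w ?v] by fastforce
    then have "V *\<^sub>v ?v = ?v"
      unfolding Vv[OF kronv2_carrier(1)] using w by (intro eq_vecI) auto
    then have KU: "K *\<^sub>v ?v = U *\<^sub>v ?v" by (simp add: Kv)
    have vsp: "valid_state_protocol (U *\<^sub>v ?v) sp" and ab: "unit_state 2 a" "unit_state 2 b"
      using ver P by (auto simp: verifies_def valid_protocol_def)
    have Uv: "U *\<^sub>v ?v \<in> carrier_vec 4" using U by (intro mult_mat_vec_carrier) auto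
    have "ver_op sp *\<^sub>v (U *\<^sub>v ?v) = U *\<^sub>v ?v"
      using vsp Uv unfolding valid_state_protocol_tests by (intro ver_op_fixed) auto
    then show "mtrace (ver_op sp * channel [K] (outer ?v ?v)) = 1"
      using mtrace_mult_channel[OF ver_op_carrier(1), of ?v "[K]" sp] K
      by (simp add: KU isometry_cinner[OF U] unit_kronv2[OF ab])
  qed
  then have ch: "channel [K] \<rho> = U * \<rho> * adj U" if "\<rho> \<in> carrier_mat 4 4" for \<rho>
    using ver kr that by (auto simp: verifies_def)
  \<comment> \<open>The sign of \<open>w\<close> cancels in \<open>outer w w\<close>, so the two
    channels are told apart on \<open>outer u w\<close> with \<open>u\<close> orthogonal to
    \<open>w\<close>: the reflection fixes \<open>u\<close> and negates \<open>w\<close>.\<close>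
  obtain u where u: "u \<in> carrier_vec 4" "u \<noteq> 0\<^sub>v 4" "cinner w u = 0"
    using exists_orthogonal_vec[of "[w]" 4] w by auto
  have Vu: "V *\<^sub>v u = u" unfolding Vv[OF u(1)] u(3) using u w by (intro eq_vecI) auto
  have Vw: "V *\<^sub>v w = - w"
    unfolding Vv[OF w] N_def[symmetric] using N w by (intro eq_vecI) auto
  have Uu: "U *\<^sub>v u \<in> carrier_vec 4" and Uw: "U *\<^sub>v w \<in> carrier_vec 4"
    using U u w by (auto intro: mult_mat_vec_carrier)
  have "K * outer u w * adj K = U * outer u w * adj U"
    using ch[of "outer u w"] u w K
    by (simp add: channel_def conjugate_outer[OF K u(1) w])
  then have o: "outer (U *\<^sub>v u) (U *\<^sub>v (- w)) = outer (U *\<^sub>v u) (U *\<^sub>v w)"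
    by (simp add: conjugate_outer[OF K u(1) w] conjugate_outer[OF U(1) u(1) w] Kv[OF u(1)] Kv[OF w] Vu Vw)
  have "cinner (U *\<^sub>v u) (U *\<^sub>v u) \<noteq> 0" "cinner (U *\<^sub>v w) (U *\<^sub>v w) \<noteq> 0"
    unfolding isometry_cinner[OF U u(1,1)] isometry_cinner[OF U w w] using u w w0
    by (simp_all add: cinner_self_eq_0)
  then have "U *\<^sub>v u \<noteq> 0\<^sub>v 4" "U *\<^sub>v w \<noteq> 0\<^sub>v 4"
    using cinner_self_eq_0 Uu Uw by fastforce+
  \<comment> \<open>At this position the entry of the output is nonzero and yet equal to its own
    negative.\<close>
  then obtain i j where i: "i < 4" "(U *\<^sub>v u) $ i \<noteq> 0" and j: "j < 4" "(U *\<^sub>v w) $ j \<noteq> 0"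
    using Uu Uw by (metis carrier_vecD eq_vecI index_zero_vec)
  have "(U *\<^sub>v (- w)) $ j = - (U *\<^sub>v w) $ j"
    using j w U by (simp add: mult_mat_vec_index[of U 4 4] sum_negf uminus_carrier_vec del: index_mult_mat_vec)
  moreover have "outer (U *\<^sub>v u) (U *\<^sub>v (- w)) $$ (i,j) = outer (U *\<^sub>v u) (U *\<^sub>v w) $$ (i,j)"
    using o by simp
  ultimately show False using i j Uu Uw U by (simp add: outer_def del: index_mult_mat_vec)
qed

section \<open>Counting test states and settings\<close>

lemma verifies_length:
  assumes U: "U \<in> carrier_mat 4 4" "adj U * U = 1\<^sub>m 4" and ver: "verifies U P"
  shows "4 \<le> length P"
proof (rule ccontr)
  assume "\<not> 4 \<le> length P"
  then have len: "length (map (\<lambda>((a,b),sp). kronv2 a b) P) < 4" by simp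
  have sub: "set (map (\<lambda>((a,b),sp). kronv2 a b) P) \<subseteq> carrier_vec 4" by auto
  obtain w where w: "w \<in> carrier_vec 4" "w \<noteq> 0\<^sub>v 4"
    and o: "\<forall>v\<in>set (map (\<lambda>((a,b),sp). kronv2 a b) P). cinner v w = 0"
    using exists_orthogonal_vec[OF len sub] by blast
  have "\<forall>((a,b),sp)\<in>set P. cinner (kronv2 a b) w = 0"
    using o by fastforce
  then show False using verifies_no_orthogonal[OF U ver w(1)] w(2) by blast
qed

lemma valid_state_protocol_nonempty: "valid_state_protocol \<phi> sp \<Longrightarrow> 1 \<le> length sp"
  by (cases sp) (auto simp: valid_state_protocol_def total_prob_def)

lemma length_le_num_settings:
  assumes "\<forall>(ab,sp)\<in>set P. 1 \<le> length sp"
  shows "length P \<le> num_settings P"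
  using assms by (induction P) (auto simp: num_settings_def)

lemma num_settings_eq_length:
  assumes "\<forall>(ab,sp)\<in>set P. 1 \<le> length sp" "num_settings P = length P" "(ab,sp) \<in> set P"
  shows "length sp = 1"
  using assms
proof (induction P)
  case (Cons x P)
  obtain ab' sp' where x: "x = (ab',sp')" by (cases x) blast
  have "length P \<le> num_settings P" using Cons.prems by (intro length_le_num_settings) auto
  then show ?case using Cons by (auto simp: x num_settings_def)
qed simp

text \<open>There are at least four test states, each with at least one setting. A total of exactly
  four leaves one setting per output state, so that \<open>single_setting_product\<close> applies to
  all outputs.\<close>

lemma verifies_num_settings:
  assumes U: "U \<in> carrier_mat 4 4" "adj U * U = 1\<^sub>m 4" and ver: "verifies U P"
  shows "4 \<le> num_settings P" "num_settings P = 4 \<Longrightarrow> (ab,sp) \<in> set P \<Longrightarrow> length sp = 1"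
proof -
  have 1: "\<forall>(ab,sp)\<in>set P. 1 \<le> length sp"
    using ver by (auto simp: verifies_def valid_protocol_def dest!: valid_state_protocol_nonempty)
  note le = verifies_length[OF U ver] length_le_num_settings[OF 1]
  show "4 \<le> num_settings P" using le by simp
  assume "num_settings P = 4" "(ab,sp) \<in> set P"
  then show "length sp = 1" using le num_settings_eq_length[OF 1] by simp
qed

text \<open>All tests of a single setting are diagonal in one product basis, so a basis vector in the
  support of the target also has eigenvalue 1.\<close>

lemma single_setting_product:
  assumes val: "valid_state_protocol \<phi> sp" and gap: "positive_gap \<phi> sp"
    and len: "length sp = 1" and \<phi>: "\<phi> \<in> carrier_vec 4" "cinner \<phi> \<phi> = 1"
  shows "product_state \<phi>"
proof -
  obtain M ts where sp: "sp = [(M,ts)]"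
    using len by (auto simp: length_Suc_conv)
  note v = val[unfolded valid_state_protocol_tests]
  have M: "local_meas M" using v by (simp add: sp)
  have M_eq: "M' = M" if "(M',S,p) \<in> set (tests sp)" for M' S p
    using that by (auto simp: sp tests_def)
  have "tests sp \<noteq> []" using v by auto
  then obtain M' S p where "(M',S,p) \<in> set (tests sp)" by (metis list.set_intros(1) neq_Nil_conv prod_cases3)
  then have S: "(M,S,p) \<in> set (tests sp)" using M_eq by blast
  then have \<phi>S: "test_op M S *\<^sub>v \<phi> = \<phi>" and S01: "S \<subseteq> {0,1} \<times> {0,1}" using v by auto
  \<comment> \<open>The target passes with certainty, so the expectation 1 is distributed over
    accepted outcomes and one of them has nonzero amplitude.\<close>
  have "(\<Sum>s\<in>S. cinner \<phi> (prod_vec M s) * cinner (prod_vec M s) \<phi>) \<noteq> 0"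
    using cinner_test_op[OF \<phi>(1,1), of M S] \<phi>S \<phi>(2) by simp
  then obtain s where s: "s \<in> S" "cinner (prod_vec M s) \<phi> \<noteq> 0"
    by (metis (no_types, lifting) mult_zero_right sum.neutral)
  then have s01: "s \<in> {0,1} \<times> {0,1}" using S01 by blast
  \<comment> \<open>An outcome with nonzero amplitude in the target is accepted by every test that
    fixes the target.\<close>
  have "test_op M' S *\<^sub>v prod_vec M s = prod_vec M s" if t: "(M',S,p) \<in> set (tests sp)" for M' S p
  proof -
    from t have M': "M' = M" by (rule M_eq)
    have S: "S \<subseteq> {0,1} \<times> {0,1}" and f: "test_op M S *\<^sub>v \<phi> = \<phi>" using v t by (auto simp: M')
    then have "s \<in> S"
      using cinner_prod_vec_test_op[OF M S s01 \<phi>(1)] s(2) f by (metis (full_types))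
    then show ?thesis
      unfolding M' by (rule test_op_prod_vec[OF M S])
  qed
  then have "\<forall>(M',S,p)\<in>set (tests sp). p = 0 \<or> test_op M' S *\<^sub>v prod_vec M s = prod_vec M s"
    by auto
  then obtain c where c: "prod_vec M s = c \<cdot>\<^sub>v \<phi>"
    using gap unfolding positive_gap_iff[OF val] by (metis prod_vec_carrier(1))
  have "cinner (prod_vec M s) (prod_vec M s) = 1"
    using prod_vec_orthonormal[OF M s01 s01] by simp
  then have cc: "cnj c * c = 1"
    unfolding c using \<phi> by (simp add: cinner_smult_left cinner_smult_right)
  let ?a = "basis_vec (fst M) (fst s)" and ?b = "basis_vec (snd M) (snd s)"
  have ab: "unit_state 2 ?a" "unit_state 2 ?b"
    using M by (auto simp: local_meas_def onb2_def basis_vec_def)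
  \<comment> \<open>The target is the basis vector times the phase \<open>cnj c\<close>, which is
    absorbed into the first factor.\<close>
  have "unit_state 2 (cnj c \<cdot>\<^sub>v ?a)"
    using ab(1) cc by (simp add: unit_state_def cinner_smult_left cinner_smult_right mult.commute)
  moreover have "\<phi> = kronv2 (cnj c \<cdot>\<^sub>v ?a) ?b"
  proof (rule eq_vecI)
    fix i assume "i < dim_vec (kronv2 (cnj c \<cdot>\<^sub>v ?a) ?b)"
    then have i: "i < 4" by simp
    then have i2: "i div 2 < 2" by simp
    have "kronv2 (cnj c \<cdot>\<^sub>v ?a) ?b $ i = cnj c * prod_vec M s $ i"
      using i i2 ab(1) by (simp add: kronv2_def prod_vec_def unit_state_def carrier_vecD[of _ 2])
    also have "\<dots> = \<phi> $ i" using i \<phi>(1) cc unfolding c by (simp add: mult.assoc[symmetric])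
    finally show "\<phi> $ i = kronv2 (cnj c \<cdot>\<^sub>v ?a) ?b $ i" by simp
  qed (use \<phi> in simp)
  ultimately show ?thesis using ab(2) by (auto simp: product_state_def)
qed

text \<open>Both factors are completed to orthonormal bases and only the outcome (0,0) is accepted.
  The single test is then the projector onto the target itself.\<close>

lemma product_state_protocol:
  assumes "product_state \<phi>"
  obtains m where "valid_state_protocol \<phi> [m]" "positive_gap \<phi> [m]"
proof -
  obtain a b where ab: "unit_state 2 a" "unit_state 2 b" and \<phi>: "\<phi> = kronv2 a b"
    using assms by (auto simp: product_state_def)
  define perp where "perp e = vec 2 (\<lambda>i. if i = 0 then - cnj (e $ 1) else cnj (e $ 0))" for e :: "complex vec"
  have onb: "onb2 (e, perp e)" if "unit_state 2 e" for e
    using that by (auto simp: onb2_def unit_state_def perp_def cinner_def sum_lessThan_2 algebra_simps)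
  define M where "M = ((a, perp a), (b, perp b))"
  have M: "local_meas M" using onb ab by (simp add: local_meas_def M_def)
  have \<phi>M: "\<phi> = prod_vec M (0,0)" by (simp add: \<phi> M_def prod_vec_def basis_vec_def)
  let ?m = "(M, [({(0,0)}, 1 :: real)])"
  have t: "tests [?m] = [(M, {(0,0)}, 1)]" by (simp add: tests_def)
  have "test_op M {(0,0)} *\<^sub>v \<phi> = \<phi>"
    unfolding \<phi>M by (rule test_op_prod_vec[OF M]) auto
  then have val: "valid_state_protocol \<phi> [?m]"
    unfolding valid_state_protocol_tests t using M by simp
  moreover have "positive_gap \<phi> [?m]"
    unfolding positive_gap_iff[OF val] t
  proof (intro ballI impI)
    fix w assume w: "w \<in> carrier_vec 4" and "\<forall>(M,S,p)\<in>set [(M, {(0,0)}, 1::real)]. p = 0 \<or> test_op M S *\<^sub>v w = w"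
    then have "test_op M {(0,0)} *\<^sub>v w = w" by simp
    then have "w $ i = cinner \<phi> w * \<phi> $ i" if "i < 4" for i
      using test_op_mult_vec[OF w that, of M "{(0,0)}"] by (simp add: \<phi>M)
    then have "w = cinner \<phi> w \<cdot>\<^sub>v \<phi>" using w by (intro eq_vecI) (auto simp: \<phi>)
    then show "\<exists>c. w = c \<cdot>\<^sub>v \<phi>" ..
  qed
  ultimately show ?thesis by (rule that)
qed

section \<open>The canonical unitary in the magic basis\<close>

definition vec4 :: "complex \<Rightarrow> complex \<Rightarrow> complex \<Rightarrow> complex \<Rightarrow> complex vec" where
  "vec4 a b c d = vec 4 (\<lambda>i. [a, b, c, d] ! i)"

text \<open>The operator with eigenvalues \<open>x, y, z, t\<close> on \<open>|00> + |11>\<close>, \<open>|00> - |11>\<close>, \<open>|01> + |10>\<close>, \<open>|01> - |10>\<close>.\<close>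

definition bell_diag :: "complex \<Rightarrow> complex \<Rightarrow> complex \<Rightarrow> complex \<Rightarrow> complex mat" where
  "bell_diag x y z t = mat 4 4 (\<lambda>(i,j).
    if i = j then (if i = 0 \<or> i = 3 then (x + y) / 2 else (z + t) / 2)
    else if i + j = 3 then (if i = 0 \<or> i = 3 then (x - y) / 2 else (z - t) / 2) else 0)"

lemma less_4_cases:
  assumes "i < (4::nat)" obtains "i = 0" | "i = 1" | "i = 2" | "i = 3"
  using assms by linarith

lemma vec4_carrier[simp]: "vec4 a b c d \<in> carrier_vec 4" "dim_vec (vec4 a b c d) = 4"
  by (simp_all add: vec4_def)

lemma vec4_index[simp]:
  "vec4 a b c d $ 0 = a" "vec4 a b c d $ Suc 0 = b" "vec4 a b c d $ 2 = c" "vec4 a b c d $ 3 = d"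
  by (simp_all add: vec4_def)

lemma eq_vec4I:
  assumes "v \<in> carrier_vec 4" "v $ 0 = a" "v $ 1 = b" "v $ 2 = c" "v $ 3 = d"
  shows "v = vec4 a b c d"
  using assms by (intro eq_vecI) (auto elim!: less_4_cases)

lemma bell_diag_carrier[simp]: "bell_diag x y z t \<in> carrier_mat 4 4"
  "dim_row (bell_diag x y z t) = 4" "dim_col (bell_diag x y z t) = 4"
  by (simp_all add: bell_diag_def)

lemma bell_diag_mult:
  "bell_diag x y z t * bell_diag x' y' z' t' = bell_diag (x * x') (y * y') (z * z') (t * t')"
proof (rule eq_matI)
  fix i j assume "i < dim_row (bell_diag (x * x') (y * y') (z * z') (t * t'))"
    "j < dim_col (bell_diag (x * x') (y * y') (z * z') (t * t'))"
  then have "i < 4" "j < 4" by simp_all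
  then show "(bell_diag x y z t * bell_diag x' y' z' t') $$ (i,j) =
      bell_diag (x * x') (y * y') (z * z') (t * t') $$ (i,j)"
    by (elim less_4_cases)
      (simp_all add: bell_diag_def scalar_prod_def atLeast0LessThan sum_lessThan_4,
        simp_all add: field_simps)
qed simp_all

lemma bell_diag_one: "bell_diag 1 1 1 1 = 1\<^sub>m 4"
  by (intro eq_matI) (auto simp: bell_diag_def)

lemma adj_bell_diag: "adj (bell_diag x y z t) = bell_diag (cnj x) (cnj y) (cnj z) (cnj t)"
  by (intro eq_matI) (auto simp: bell_diag_def adj_def)

lemma bell_diag_pow: "bell_diag x y z t ^\<^sub>m k = bell_diag (x ^ k) (y ^ k) (z ^ k) (t ^ k)"
  by (induction k) (simp_all add: bell_diag_one bell_diag_mult mult.commute)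

text \<open>Powers act on the eigenvalues, and each nonzero entry is half a sum or half a difference
  of two eigenvalues. The series for an entry is therefore a combination of two scalar exponential
  series.\<close>

lemma mexp_bell_diag: "mexp (bell_diag x y z t) = bell_diag (exp x) (exp y) (exp z) (exp t)"
proof -
  have "(\<lambda>k. x ^ k / of_nat (fact k)) sums exp x" for x :: complex
    using exp_converges[of x] by (simp add: scaleR_conv_of_real field_simps)
  from sums_divide[OF sums_add[OF this this], of _ _ 2] sums_divide[OF sums_diff[OF this this], of _ _ 2]
  have "(\<lambda>k. (x ^ k + y ^ k) / 2 / of_nat (fact k)) sums ((exp x + exp y) / 2)"
    "(\<lambda>k. (x ^ k - y ^ k) / 2 / of_nat (fact k)) sums ((exp x - exp y) / 2)" for x y :: complex
    by (simp_all only: add_divide_distrib[symmetric] diff_divide_distrib[symmetric] divide_divide_eq_left mult.commute)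
  note s = this[simplified]
  show ?thesis
  proof (rule eq_matI)
    fix i j assume "i < dim_row (bell_diag (exp x) (exp y) (exp z) (exp t))"
      "j < dim_col (bell_diag (exp x) (exp y) (exp z) (exp t))"
    then have ij: "i < 4" "j < 4" by simp_all
    have "(\<lambda>k. bell_diag (x ^ k) (y ^ k) (z ^ k) (t ^ k) $$ (i,j) / of_nat (fact k)) sums
        bell_diag (exp x) (exp y) (exp z) (exp t) $$ (i,j)"
      using ij s by (auto simp: bell_diag_def)
    then show "mexp (bell_diag x y z t) $$ (i,j) = bell_diag (exp x) (exp y) (exp z) (exp t) $$ (i,j)"
      using ij by (simp add: mexp_def bell_diag_pow sums_iff del: of_nat_fact)
  qed (simp_all add: mexp_def)
qed

lemma bell_diag_add:
  "bell_diag x y z t + bell_diag x' y' z' t' = bell_diag (x + x') (y + y') (z + z') (t + t')"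
  by (intro eq_matI) (auto simp: bell_diag_def add_divide_distrib diff_divide_distrib)

lemma bell_diag_smult: "c \<cdot>\<^sub>m bell_diag x y z t = bell_diag (c * x) (c * y) (c * z) (c * t)"
  by (intro eq_matI) (auto simp: bell_diag_def algebra_simps add_divide_distrib diff_divide_distrib)

text \<open>The Bell states are joint eigenvectors of the three Pauli products, which is why the
  exponential of their combination can be read off from eigenvalues.\<close>

lemma kron2_sigma:
  "kron2 sigma1 sigma1 = bell_diag 1 (-1) 1 (-1)"
  "kron2 sigma2 sigma2 = bell_diag (-1) 1 1 (-1)"
  "kron2 sigma3 sigma3 = bell_diag 1 1 (-1) (-1)"
proof -
  have pauli: "sigma1 $$ (0,0) = 0" "sigma1 $$ (0,Suc 0) = 1" "sigma1 $$ (Suc 0,0) = 1" "sigma1 $$ (Suc 0,Suc 0) = 0"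
    "sigma2 $$ (0,0) = 0" "sigma2 $$ (0,Suc 0) = -\<i>" "sigma2 $$ (Suc 0,0) = \<i>" "sigma2 $$ (Suc 0,Suc 0) = 0"
    "sigma3 $$ (0,0) = 1" "sigma3 $$ (0,Suc 0) = 0" "sigma3 $$ (Suc 0,0) = 0" "sigma3 $$ (Suc 0,Suc 0) = -1"
    by (simp_all add: sigma1_def sigma2_def sigma3_def mat_of_rows_list_def)
  have eqI: "kron2 A B = bell_diag x y z t"
    if "\<And>i j. i < 4 \<Longrightarrow> j < 4 \<Longrightarrow> kron2 A B $$ (i,j) = bell_diag x y z t $$ (i,j)" for A B x y z t
    using that by (intro eq_matI) (auto simp: kron2_def)
  show "kron2 sigma1 sigma1 = bell_diag 1 (-1) 1 (-1)"
    by (rule eqI, elim less_4_cases) (simp_all add: kron2_def bell_diag_def pauli)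
  show "kron2 sigma2 sigma2 = bell_diag (-1) 1 1 (-1)"
    by (rule eqI, elim less_4_cases) (simp_all add: kron2_def bell_diag_def pauli)
  show "kron2 sigma3 sigma3 = bell_diag 1 1 (-1) (-1)"
    by (rule eqI, elim less_4_cases) (simp_all add: kron2_def bell_diag_def pauli)
qed

lemma canonical_U_bell_diag:
  "canonical_U a1 a2 a3 = bell_diag (cis (a2 - a1 - a3)) (cis (a1 - a2 - a3)) (cis (a3 - a1 - a2)) (cis (a1 + a2 + a3))"
  unfolding canonical_U_def kron2_sigma bell_diag_smult bell_diag_add mexp_bell_diag cis_conv_exp
  by (simp add: algebra_simps)

lemma bell_diag_isometry:
  assumes "cmod x = 1" "cmod y = 1" "cmod z = 1" "cmod t = 1"
  shows "adj (bell_diag x y z t) * bell_diag x y z t = 1\<^sub>m 4"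
proof -
  have "cnj x * x = 1" if "cmod x = 1" for x :: complex
    using complex_norm_square[of x] that by (simp add: mult.commute)
  then show ?thesis using assms by (simp add: adj_bell_diag bell_diag_mult bell_diag_one)
qed

lemma bell_diag_mult_vec4:
  "bell_diag x y z t *\<^sub>v vec4 a b c d =
    vec4 ((x + y) / 2 * a + (x - y) / 2 * d) ((z + t) / 2 * b + (z - t) / 2 * c)
      ((z - t) / 2 * b + (z + t) / 2 * c) ((x - y) / 2 * a + (x + y) / 2 * d)"
  by (intro eq_vec4I)
    (simp_all add: bell_diag_def scalar_prod_def atLeast0LessThan sum_lessThan_4 mult_mat_vec_carrier[of _ 4 4])

lemma cinner_vec4: "cinner (vec4 a b c d) v = cnj a * v $ 0 + cnj b * v $ 1 + cnj c * v $ 2 + cnj d * v $ 3"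
  by (simp add: cinner_def sum_lessThan_4)

text \<open>The phases of the magic basis vectors are chosen such that the concurrence
  \<open>2 |v00 v11 - v01 v10|\<close> of \<open>magic m1 m2 m3 m4\<close> is \<open>|m1\<^sup>2 + m2\<^sup>2 + m3\<^sup>2 + m4\<^sup>2|\<close>.\<close>

definition magic :: "complex \<Rightarrow> complex \<Rightarrow> complex \<Rightarrow> complex \<Rightarrow> complex vec" where
  "magic m1 m2 m3 m4 = vec4 ((m1 + \<i> * m2) / of_real (sqrt 2)) ((\<i> * m3 + m4) / of_real (sqrt 2))
     ((\<i> * m3 - m4) / of_real (sqrt 2)) ((m1 - \<i> * m2) / of_real (sqrt 2))"

lemma sqrt2_mult: "complex_of_real (sqrt 2) * complex_of_real (sqrt 2) = 2"
  by (simp flip: of_real_mult)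

lemma bell_diag_mult_magic:
  "bell_diag x y z t *\<^sub>v magic m1 m2 m3 m4 = magic (x * m1) (y * m2) (z * m3) (t * m4)"
  unfolding magic_def bell_diag_mult_vec4
  by (intro eq_vec4I) (simp_all add: field_simps)

lemma cinner_magic:
  "cinner (magic m1 m2 m3 m4) (magic n1 n2 n3 n4) = cnj m1 * n1 + cnj m2 * n2 + cnj m3 * n3 + cnj m4 * n4"
proof -
  have "a / complex_of_real (sqrt 2) * (b / complex_of_real (sqrt 2)) = a * b / 2" for a b
    by (simp add: sqrt2_mult)
  then show ?thesis
    unfolding magic_def cinner_vec4 complex_cnj_divide complex_cnj_complex_of_real
    by (simp add: sqrt2_mult algebra_simps add_divide_distrib diff_divide_distrib)
qed

lemma magic_cases:
  assumes "w \<in> carrier_vec 4"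
  obtains n1 n2 n3 n4 where "w = magic n1 n2 n3 n4"
proof
  have r: "x / complex_of_real (sqrt 2) / complex_of_real (sqrt 2) = x / 2" for x
    by (simp add: sqrt2_mult)
  show "w = magic ((w $ 0 + w $ 3) / of_real (sqrt 2)) (- \<i> * (w $ 0 - w $ 3) / of_real (sqrt 2))
      (- \<i> * (w $ 1 + w $ 2) / of_real (sqrt 2)) ((w $ 1 - w $ 2) / of_real (sqrt 2))"
    unfolding magic_def using assms
    by (intro eq_vec4I) (simp_all add: add_divide_distrib diff_divide_distrib r sqrt2_mult algebra_simps)
qed

lemma magic_zero: "magic 0 0 0 0 = 0\<^sub>v 4"
  unfolding magic_def by (intro eq_vec4I[symmetric]) auto

lemma magic_carrier[simp]: "magic m1 m2 m3 m4 \<in> carrier_vec 4"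
  by (simp add: magic_def)

section \<open>Product states\<close>

definition vec2 :: "complex \<Rightarrow> complex \<Rightarrow> complex vec" where
  "vec2 a b = vec 2 (\<lambda>i. if i = 0 then a else b)"

lemma vec2_index[simp]: "vec2 a b $ 0 = a" "vec2 a b $ Suc 0 = b" "dim_vec (vec2 a b) = 2" "vec2 a b \<in> carrier_vec 2"
  by (simp_all add: vec2_def)

lemma kronv2_vec4: "kronv2 a b = vec4 (a $ 0 * b $ 0) (a $ 0 * b $ 1) (a $ 1 * b $ 0) (a $ 1 * b $ 1)"
  by (intro eq_vec4I) (simp_all add: kronv2_def)

lemma unit_vec2: "unit_state 2 (vec2 a b) \<longleftrightarrow> cnj a * a + cnj b * b = 1"
  by (simp add: unit_state_def cinner_def sum_lessThan_2)

lemma cmod_square: "(complex_of_real (cmod a))\<^sup>2 = cnj a * a"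
  by (simp only: complex_norm_square mult.commute flip: of_real_power)

lemma product_state_kronv2: "unit_state 2 a \<Longrightarrow> unit_state 2 b \<Longrightarrow> product_state (kronv2 a b)"
  unfolding product_state_def by blast

lemma product_state_det:
  assumes "product_state (vec4 a b c d)"
  shows "a * d = b * c"
proof -
  obtain u v where e: "vec4 a b c d = kronv2 u v" using assms by (auto simp: product_state_def)
  have "a = u $ 0 * v $ 0" "b = u $ 0 * v $ 1" "c = u $ 1 * v $ 0" "d = u $ 1 * v $ 1"
    using e unfolding kronv2_vec4 by (metis vec4_index One_nat_def)+
  then show ?thesis by simp
qed

text \<open>The coefficient matrix with rows \<open>(a, b)\<close> and \<open>(c, d)\<close> has
  determinant zero, hence rank at most one. If the first row is nonzero, it gives the second tensor
  factor after division by its length \<open>r\<close>, and the first factor is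
  \<open>(r, t)\<close>.\<close>

lemma product_stateI:
  assumes det: "a * d = b * c" and norm: "cinner (vec4 a b c d) (vec4 a b c d) = 1"
  shows "product_state (vec4 a b c d)"
proof (cases "a = 0 \<and> b = 0")
  case True
  have "unit_state 2 (vec2 0 1)" "unit_state 2 (vec2 c d)"
    using norm True by (simp_all add: unit_vec2 cinner_vec4)
  moreover have "vec4 a b c d = kronv2 (vec2 0 1) (vec2 c d)"
    using True by (simp add: kronv2_vec4)
  ultimately show ?thesis unfolding product_state_def by blast
next
  case False
  define r where "r = sqrt ((cmod a)\<^sup>2 + (cmod b)\<^sup>2)"
  have "0 < (cmod a)\<^sup>2 + (cmod b)\<^sup>2"
    using False by (auto simp: sum_power2_gt_zero_iff)
  then have r0: "r > 0" and "r\<^sup>2 = (cmod a)\<^sup>2 + (cmod b)\<^sup>2"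
    by (simp_all add: r_def)
  then have r2: "complex_of_real r * complex_of_real r = cnj a * a + cnj b * b"
    by (simp add: power2_eq_square flip: of_real_mult) (simp add: cmod_square flip: power2_eq_square)
  \<comment> \<open>The coefficient of the second row along the normalised first row.\<close>
  define t where "t = (cnj a * c + cnj b * d) / of_real r"
  have B: "unit_state 2 (vec2 (a / of_real r) (b / of_real r))"
    using r0 by (simp add: unit_vec2 add_divide_distrib[symmetric] r2[symmetric])
  have c: "t * (a / of_real r) = c"
  proof -
    have "(cnj a * c + cnj b * d) * a = cnj a * a * c + cnj b * (a * d)" by (simp add: algebra_simps)
    also have "\<dots> = of_real r * of_real r * c" unfolding r2 det by (simp add: algebra_simps)
    finally show ?thesis using r0 by (simp add: t_def)
  qed
  have d: "t * (b / of_real r) = d"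
  proof -
    have "(cnj a * c + cnj b * d) * b = cnj a * (b * c) + cnj b * b * d" by (simp add: algebra_simps)
    also have "\<dots> = of_real r * of_real r * d" unfolding r2 det[symmetric] by (simp add: algebra_simps)
    finally show ?thesis using r0 by (simp add: t_def)
  qed
  have e: "vec4 a b c d = kronv2 (vec2 (of_real r) t) (vec2 (a / of_real r) (b / of_real r))"
    using r0 c d by (simp add: kronv2_vec4)
  have "cinner (vec2 (of_real r) t) (vec2 (of_real r) t) = 1"
    using norm B unfolding e by (simp add: cinner_kronv2 unit_state_def)
  then have "unit_state 2 (vec2 (of_real r) t)" by (simp add: unit_state_def)
  then show ?thesis unfolding product_state_def using B e by blast
qed

text \<open>The sum of squares is twice the determinant of the coefficient matrix in the
  computational basis.\<close>

lemma product_state_magicI: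
  assumes "m1\<^sup>2 + m2\<^sup>2 + m3\<^sup>2 + m4\<^sup>2 = 0" "cnj m1 * m1 + cnj m2 * m2 + cnj m3 * m3 + cnj m4 * m4 = 1"
  shows "product_state (magic m1 m2 m3 m4)"
  unfolding magic_def
proof (rule product_stateI)
  have "(m1 + \<i> * m2) * (m1 - \<i> * m2) - (\<i> * m3 + m4) * (\<i> * m3 - m4) = m1\<^sup>2 + m2\<^sup>2 + m3\<^sup>2 + m4\<^sup>2"
    by (simp add: power2_eq_square algebra_simps)
  then have "(m1 + \<i> * m2) * (m1 - \<i> * m2) = (\<i> * m3 + m4) * (\<i> * m3 - m4)"
    using assms(1) by simp
  then show "(m1 + \<i> * m2) / of_real (sqrt 2) * ((m1 - \<i> * m2) / of_real (sqrt 2)) =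
      (\<i> * m3 + m4) / of_real (sqrt 2) * ((\<i> * m3 - m4) / of_real (sqrt 2))"
    by simp
qed (use assms(2) cinner_magic[of m1 m2 m3 m4 m1 m2 m3 m4] in \<open>simp add: magic_def\<close>)

section \<open>Protocols\<close>

text \<open>The function \<open>n\<close> prescribes the number of settings for each test state, so
  the construction serves both the four-setting and the five-setting protocols. The last clause on
  \<open>P\<close> identifies its test states, from which entanglement freeness is read off.\<close>

lemma protocol_exists:
  assumes U: "U \<in> carrier_mat 4 4" "adj U * U = 1\<^sub>m 4"
    and sp: "\<And>a b. (a,b) \<in> set L \<Longrightarrow> unit_state 2 a \<and> unit_state 2 b \<and>
      (\<exists>sp. valid_state_protocol (U *\<^sub>v kronv2 a b) sp \<and> positive_gap (U *\<^sub>v kronv2 a b) sp \<and> length sp = n (a,b))"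
    and span: "\<And>w. w \<in> carrier_vec 4 \<Longrightarrow> \<forall>(a,b)\<in>set L. cinner (kronv2 a b) w = 0 \<Longrightarrow> w = 0\<^sub>v 4"
    and hub: "(a0,b0) \<in> set L" "\<forall>(a,b)\<in>set L. cinner (kronv2 a0 b0) (kronv2 a b) \<noteq> 0"
  obtains P where "verifies U P" "ordinary U P" "num_settings P = sum_list (map n L)" "fst ` set P = set L"
proof -
  obtain f where f: "\<And>a b. (a,b) \<in> set L \<Longrightarrow> valid_state_protocol (U *\<^sub>v kronv2 a b) (f (a,b)) \<and>
      positive_gap (U *\<^sub>v kronv2 a b) (f (a,b)) \<and> length (f (a,b)) = n (a,b)"
  proof -
    have "\<forall>ab. \<exists>s. ab \<in> set L \<longrightarrow> valid_state_protocol (U *\<^sub>v kronv2 (fst ab) (snd ab)) s \<and>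
      positive_gap (U *\<^sub>v kronv2 (fst ab) (snd ab)) s \<and> length s = n ab"
      using sp by (metis prod.collapse)
    then obtain f where "\<forall>ab. ab \<in> set L \<longrightarrow> valid_state_protocol (U *\<^sub>v kronv2 (fst ab) (snd ab)) (f ab) \<and>
      positive_gap (U *\<^sub>v kronv2 (fst ab) (snd ab)) (f ab) \<and> length (f ab) = n ab"
      by metis
    then show ?thesis using that by fastforce
  qed
  let ?P = "map (\<lambda>ab. (ab, f ab)) L"
  have "valid_protocol U ?P" "ordinary U ?P"
    using f sp by (auto simp: valid_protocol_def ordinary_def)
  moreover have "verifies U ?P"
  proof (rule verifiesI[OF U])
    show "((a0,b0), f (a0,b0)) \<in> set ?P" using hub(1) by auto
    show "\<forall>((a,b),sp)\<in>set ?P. cinner (kronv2 a0 b0) (kronv2 a b) \<noteq> 0" using hub(2) by auto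
    fix w assume "w \<in> carrier_vec 4" "\<forall>((a,b),sp)\<in>set ?P. cinner (kronv2 a b) w = 0"
    then show "w = 0\<^sub>v 4" by (intro span) auto
  qed (use calculation in auto)
  moreover have "num_settings ?P = sum_list (map n L)"
    using f by (auto simp: num_settings_def comp_def intro!: arg_cong[where f = sum_list])
  moreover have "fst ` set ?P = set L" by force
  ultimately show ?thesis using that by blast
qed

lemma entanglement_free_protocol_exists:
  assumes U: "U \<in> carrier_mat 4 4" "adj U * U = 1\<^sub>m 4"
    and prod: "\<And>a b. (a,b) \<in> set L \<Longrightarrow> unit_state 2 a \<and> unit_state 2 b \<and> product_state (U *\<^sub>v kronv2 a b)"
    and span: "\<And>w. w \<in> carrier_vec 4 \<Longrightarrow> \<forall>(a,b)\<in>set L. cinner (kronv2 a b) w = 0 \<Longrightarrow> w = 0\<^sub>v 4"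
    and hub: "(a0,b0) \<in> set L" "\<forall>(a,b)\<in>set L. cinner (kronv2 a0 b0) (kronv2 a b) \<noteq> 0"
  shows "\<exists>P. verifies U P \<and> ordinary U P \<and> num_settings P = length L \<and> entanglement_free U P"
proof -
  have "unit_state 2 a \<and> unit_state 2 b \<and>
      (\<exists>sp. valid_state_protocol (U *\<^sub>v kronv2 a b) sp \<and> positive_gap (U *\<^sub>v kronv2 a b) sp \<and> length sp = (\<lambda>_. 1) (a,b))"
    if "(a,b) \<in> set L" for a b
    using prod[OF that] product_state_protocol[of "U *\<^sub>v kronv2 a b"]
    by (metis One_nat_def length_Cons list.size(3))
  then obtain P where P: "verifies U P" "ordinary U P" "num_settings P = sum_list (map (\<lambda>_. 1) L)" "fst ` set P = set L"
    using protocol_exists[OF U _ span hub, of "\<lambda>_. 1"] by metis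
  have "(a,b) \<in> set L" if "((a,b),sp) \<in> set P" for a b sp
    using that P(4) by force
  then have "entanglement_free U P"
    using prod by (auto simp: entanglement_free_def)
  then show ?thesis using P by (auto simp: sum_list_triv)
qed


section \<open>Three equal eigenvalues\<close>

definition ket0 :: "complex vec" where "ket0 = vec2 1 0"
definition ket1 :: "complex vec" where "ket1 = vec2 0 1"
definition ket_plus :: "complex vec" where "ket_plus = vec2 (1 / of_real (sqrt 2)) (1 / of_real (sqrt 2))"
definition ket_minus :: "complex vec" where "ket_minus = vec2 (1 / of_real (sqrt 2)) (- 1 / of_real (sqrt 2))"

lemmas ket_defs = ket0_def ket1_def ket_plus_def ket_minus_def

lemma unit_kets: "unit_state 2 ket0" "unit_state 2 ket1" "unit_state 2 ket_plus" "unit_state 2 ket_minus"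
  by (simp_all add: ket_defs unit_vec2 sqrt2_mult)

text \<open>The first three states are symmetric under exchange of the qubits; the fourth has a
  singlet component, without which the list could not span. The first state is the hub.\<close>

definition kets :: "(complex vec \<times> complex vec) list" where
  "kets = [(ket_plus, ket_plus), (ket0, ket0), (ket1, ket1), (ket0, ket1)]"

lemma kronv2_kets:
  "kronv2 ket_plus ket_plus = vec4 (1/2) (1/2) (1/2) (1/2)" "kronv2 ket0 ket0 = vec4 1 0 0 0"
  "kronv2 ket1 ket1 = vec4 0 0 0 1" "kronv2 ket0 ket1 = vec4 0 1 0 0" "kronv2 ket1 ket0 = vec4 0 0 1 0"
  by (simp_all add: kronv2_vec4 ket_defs sqrt2_mult)

lemma kets_hub: "\<forall>(a,b)\<in>set kets. cinner (kronv2 ket_plus ket_plus) (kronv2 a b) \<noteq> 0"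
  by (simp add: kets_def kronv2_kets cinner_vec4)

lemma kets_span:
  assumes "w \<in> carrier_vec 4" "\<forall>(a,b)\<in>set kets. cinner (kronv2 a b) w = 0"
  shows "w = 0\<^sub>v 4"
proof -
  have "w = vec4 0 0 0 0"
    using assms by (intro eq_vec4I) (auto simp: kets_def kronv2_kets cinner_vec4)
  then show ?thesis using magic_zero by (simp add: magic_def)
qed

text \<open>The operator acts as \<open>e\<close> on the symmetric subspace and as \<open>f\<close>
  on the singlet, so symmetric inputs only acquire the factor \<open>e\<close>.\<close>

lemma isotropic_mult_kets:
  "bell_diag e e e f *\<^sub>v kronv2 ket_plus ket_plus = e \<cdot>\<^sub>v kronv2 ket_plus ket_plus"
  "bell_diag e e e f *\<^sub>v kronv2 ket0 ket0 = e \<cdot>\<^sub>v kronv2 ket0 ket0"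
  "bell_diag e e e f *\<^sub>v kronv2 ket1 ket1 = e \<cdot>\<^sub>v kronv2 ket1 ket1"
  "bell_diag e e e f *\<^sub>v kronv2 ket0 ket1 = vec4 0 ((e + f) / 2) ((e - f) / 2) 0"
  unfolding kronv2_kets bell_diag_mult_vec4
  by (rule eq_vec4I[symmetric]; simp add: field_simps)+

lemma product_state_smult:
  assumes "product_state v" "cmod c = 1"
  shows "product_state (c \<cdot>\<^sub>v v)"
proof -
  obtain a b where ab: "unit_state 2 a" "unit_state 2 b" "v = kronv2 a b"
    using assms(1) by (auto simp: product_state_def)
  have "cnj c * c = 1" using complex_norm_square[of c] assms(2) by (simp add: mult.commute)
  then have "unit_state 2 (c \<cdot>\<^sub>v a)"
    using ab(1) by (simp add: unit_state_def cinner_smult_left cinner_smult_right mult.assoc[symmetric])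
  moreover have "c \<cdot>\<^sub>v v = kronv2 (c \<cdot>\<^sub>v a) b"
    using ab by (intro eq_vecI) (auto simp: kronv2_def unit_state_def)
  ultimately show ?thesis using ab(2) by (auto simp: product_state_def)
qed

lemma isotropic_product_output:
  assumes "cmod e = 1" "ab \<in> {(ket_plus, ket_plus), (ket0, ket0), (ket1, ket1)}"
  shows "product_state (bell_diag e e e f *\<^sub>v kronv2 (fst ab) (snd ab))"
proof -
  have "product_state (kronv2 (fst ab) (snd ab))"
    using assms(2) unit_kets by (auto intro!: product_state_kronv2)
  then have "product_state (e \<cdot>\<^sub>v kronv2 (fst ab) (snd ab))"
    using assms(1) by (rule product_state_smult)
  then show ?thesis using assms(2) by (auto simp: isotropic_mult_kets)
qed

text \<open>Up to sign, four times the determinant of the output coefficients is (e^2 - f^2)(s -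
  t)^2, where \<open>s - t\<close> is proportional to the singlet amplitude of the input. It
  vanishes only if \<open>a\<close> and \<open>b\<close> are linearly dependent.\<close>

lemma isotropic_product_input:
  assumes ef: "e\<^sup>2 \<noteq> f\<^sup>2" and prod: "product_state (bell_diag e e e f *\<^sub>v kronv2 a b)"
  shows "a $ 0 * b $ 1 = a $ 1 * b $ 0"
proof -
  define s t where "s = a $ 0 * b $ 1" and "t = a $ 1 * b $ 0"
  have st: "a $ 0 * b $ 0 * (a $ 1 * b $ 1) = s * t" by (simp add: s_def t_def)
  have "e * (a $ 0 * b $ 0) * (e * (a $ 1 * b $ 1)) =
      ((e + f) / 2 * s + (e - f) / 2 * t) * ((e - f) / 2 * s + (e + f) / 2 * t)"
    using product_state_det[OF prod[unfolded kronv2_vec4 bell_diag_mult_vec4]] by (simp add: s_def t_def)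
  moreover have "e * (a $ 0 * b $ 0) * (e * (a $ 1 * b $ 1)) = e * e * (s * t)"
    using st by (simp add: mult_ac)
  moreover have "(e\<^sup>2 - f\<^sup>2) * (s - t)\<^sup>2 =
      4 * (((e + f) / 2 * s + (e - f) / 2 * t) * ((e - f) / 2 * s + (e + f) / 2 * t)) - 4 * (e * e * (s * t))"
    by (simp add: power2_eq_square field_simps)
  ultimately have "(e\<^sup>2 - f\<^sup>2) * (s - t)\<^sup>2 = 0" by simp
  then show ?thesis using ef by (simp add: s_def t_def)
qed

lemma isotropic_not_all_product:
  assumes ef: "e\<^sup>2 \<noteq> f\<^sup>2" "cmod e = 1" "cmod f = 1"
    and ver: "verifies (bell_diag e e e f) P"
  shows "\<exists>((a,b),sp)\<in>set P. \<not> product_state (bell_diag e e e f *\<^sub>v kronv2 a b)"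
proof (rule ccontr)
  assume no: "\<not> ?thesis"
  \<comment> \<open>This is the unnormalised singlet, orthogonal to every test state with a product
    output; that it should be zero is the contradiction.\<close>
  have "vec4 0 1 (-1) 0 = 0\<^sub>v 4"
  proof (rule verifies_no_orthogonal[OF bell_diag_carrier(1) bell_diag_isometry ver])
    show "\<forall>((a,b),sp)\<in>set P. cinner (kronv2 a b) (vec4 0 1 (- 1) 0) = 0"
    proof clarify
      fix a b sp assume "((a,b),sp) \<in> set P"
      then have "a $ 0 * b $ 1 = a $ 1 * b $ 0"
        using no by (intro isotropic_product_input[OF ef(1)]) auto
      then have "cnj (a $ 0 * b $ 1) = cnj (a $ 1 * b $ 0)" by simp
      then show "cinner (kronv2 a b) (vec4 0 1 (- 1) 0) = 0"
        unfolding kronv2_vec4 cinner_vec4 by simp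
    qed
  qed (use ef in auto)
  then have "vec4 0 1 (-1) 0 $ 1 = 0\<^sub>v 4 $ 1" by simp
  then show False by simp
qed

text \<open>The second setting rejects only the product vector with first factor \<open>ket_plus\<close> that is orthogonal
  to the target, which removes the remaining vector of \<open>span {|01>, |10>}\<close>.\<close>

lemma two_setting_protocol:
  assumes pq: "p \<noteq> 0" "q \<noteq> 0" and norm: "cnj p * p + cnj q * q = 1"
  shows "\<exists>sp. valid_state_protocol (vec4 0 p q 0) sp \<and> positive_gap (vec4 0 p q 0) sp \<and> length sp = 2"
proof -
  let ?\<phi> = "vec4 0 p q 0"
  define M1 where "M1 = ((ket0, ket1), (ket0, ket1))"
  \<comment> \<open>Finding the first qubit in \<open>ket_plus\<close> leaves the second in the
    direction \<open>(q, p)\<close>. The basis vector orthogonal to this is outcome 0, so (0,0)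
    never occurs on the target, and \<open>S2\<close> accepts the other three outcomes.\<close>
  define M2 where "M2 = ((ket_plus, ket_minus), (vec2 (cnj p) (- cnj q), vec2 q p))"
  define S1 where "S1 = {(0::nat,1::nat),(1,0)}"
  define S2 where "S2 = {(0::nat,1::nat),(1,0),(1,1)}"
  have sub: "S1 \<subseteq> {0,1} \<times> {0,1}" "S2 \<subseteq> {0,1} \<times> {0,1}" by (auto simp: S1_def S2_def)
  have norm': "p * cnj p + q * cnj q = 1" using norm by (simp add: mult.commute)
  have M1: "local_meas M1"
    using unit_kets by (simp add: local_meas_def M1_def onb2_def) (simp add: ket_defs cinner_def sum_lessThan_2)
  have M2: "local_meas M2"
    using unit_kets norm norm'
    by (simp add: local_meas_def M2_def onb2_def unit_vec2) (simp add: ket_defs cinner_def sum_lessThan_2 algebra_simps)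
  define sp :: state_protocol where "sp = [(M1, [(S1, 1/2)]), (M2, [(S2, 1/2)])]"
  have t: "tests sp = [(M1, S1, 1/2), (M2, S2, 1/2)]" by (simp add: tests_def sp_def)
  let ?r = "1 / complex_of_real (sqrt 2)"
  have rr: "?r * ?r = 1 / 2" by (simp add: sqrt2_mult)
  have b1: "prod_vec M1 (0, Suc 0) = vec4 0 1 0 0" "prod_vec M1 (Suc 0, 0) = vec4 0 0 1 0"
    by (simp_all add: prod_vec_def basis_vec_def M1_def kronv2_kets)
  have b2: "prod_vec M2 (0, 0) = vec4 (?r * cnj p) (?r * - cnj q) (?r * cnj p) (?r * - cnj q)"
    "prod_vec M2 (0, Suc 0) = vec4 (?r * q) (?r * p) (?r * q) (?r * p)"
    "prod_vec M2 (Suc 0, 0) = vec4 (?r * cnj p) (?r * - cnj q) (- ?r * cnj p) (- ?r * - cnj q)"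
    "prod_vec M2 (Suc 0, Suc 0) = vec4 (?r * q) (?r * p) (- ?r * q) (- ?r * p)"
    by (simp_all add: prod_vec_def basis_vec_def M2_def kronv2_vec4 ket_defs)
  have T1: "test_op M1 S1 *\<^sub>v w = vec4 0 (w $ 1) (w $ 2) 0" if "w \<in> carrier_vec 4" for w
    using that by (intro eq_vec4I)
      (simp_all add: test_op_mult_vec S1_def b1 cinner_vec4 del: index_mult_mat_vec)
  have c: "cinner (prod_vec M2 (0, Suc 0)) ?\<phi> = ?r"
    "cinner (prod_vec M2 (Suc 0, 0)) ?\<phi> = ?r * (- 2 * p * q)"
    "cinner (prod_vec M2 (Suc 0, Suc 0)) ?\<phi> = ?r * (cnj p * p - cnj q * q)"
    using norm unfolding b2 cinner_vec4 by (simp_all add: field_simps)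
  have rx: "?r * x * (?r * y) = x * y / 2" "- ?r * x * (?r * y) = - (x * y) / 2" "?r * x * ?r = x / 2" for x y
    using rr by (simp_all add: sqrt2_mult)
  have T2: "test_op M2 S2 *\<^sub>v ?\<phi> = ?\<phi>"
  proof (rule eq_vec4I)
    have sum: "(test_op M2 S2 *\<^sub>v ?\<phi>) $ i = prod_vec M2 (0, Suc 0) $ i * ?r
      + prod_vec M2 (Suc 0, 0) $ i * (?r * (- 2 * p * q))
      + prod_vec M2 (Suc 0, Suc 0) $ i * (?r * (cnj p * p - cnj q * q))" if "i < 4" for i
      using that by (simp add: test_op_mult_vec S2_def c del: index_mult_mat_vec)
    \<comment> \<open>In each component the squared norm 1 of the target factors out: 1 - 1 gives
      the zero entries, and half of 1 + 1 gives \<open>p\<close> and \<open>q\<close>.\<close>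
    have "q / 2 + cnj p * (- 2 * p * q) / 2 + q * (cnj p * p - cnj q * q) / 2 = q / 2 * (1 - (cnj p * p + cnj q * q))"
      by (simp add: field_simps)
    then show "(test_op M2 S2 *\<^sub>v ?\<phi>) $ 0 = 0"
      using sum[of 0] unfolding b2 vec4_index rx norm by simp
    have "p / 2 + - cnj q * (- 2 * p * q) / 2 + p * (cnj p * p - cnj q * q) / 2 = p / 2 * (1 + (cnj p * p + cnj q * q))"
      by (simp add: field_simps)
    then show "(test_op M2 S2 *\<^sub>v ?\<phi>) $ 1 = p"
      using sum[of 1] unfolding b2 vec4_index rx norm One_nat_def by simp
    have "q / 2 + - (cnj p * (- 2 * p * q)) / 2 + - (q * (cnj p * p - cnj q * q)) / 2 = q / 2 * (1 + (cnj p * p + cnj q * q))"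
      by (simp add: field_simps)
    then show "(test_op M2 S2 *\<^sub>v ?\<phi>) $ 2 = q"
      using sum[of 2] unfolding b2 vec4_index rx norm by simp
    have "p / 2 + - (- cnj q * (- 2 * p * q)) / 2 + - (p * (cnj p * p - cnj q * q)) / 2 = p / 2 * (1 - (cnj p * p + cnj q * q))"
      by (simp add: field_simps)
    then show "(test_op M2 S2 *\<^sub>v ?\<phi>) $ 3 = 0"
      using sum[of 3] unfolding b2 vec4_index rx norm by simp
  qed simp
  have val: "valid_state_protocol ?\<phi> sp"
    unfolding valid_state_protocol_tests t using M1 M2 sub T1[of ?\<phi>] T2 by (simp add: sp_def)
  have "positive_gap ?\<phi> sp"
    unfolding positive_gap_iff[OF val] t
  proof (intro ballI impI)
    fix w assume w: "w \<in> carrier_vec 4"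
      and "\<forall>(M,S,p)\<in>set [(M1, S1, 1/2), (M2, S2, 1/2 :: real)]. p = 0 \<or> test_op M S *\<^sub>v w = w"
    then have w1: "vec4 0 (w $ 1) (w $ 2) 0 = w" and w2: "test_op M2 S2 *\<^sub>v w = w"
      using T1[OF w] by simp_all
    have "cinner (prod_vec M2 (0,0)) w = 0"
      using cinner_prod_vec_test_op[OF M2 sub(2) _ w, of "(0,0)"] w2 by (simp add: S2_def)
    moreover have "w $ 0 = 0" "w $ 3 = 0" using w1 by (metis vec4_index(1), metis vec4_index(4))
    ultimately have "?r * (p * w $ 2 - q * w $ 1) = 0"
      unfolding b2 cinner_vec4 by (simp add: algebra_simps)
    then have "p * w $ 2 = q * w $ 1" by simp
    then have "w = (w $ 1 / p) \<cdot>\<^sub>v ?\<phi>"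
      using pq by (subst w1[symmetric], intro eq_vec4I[symmetric]) (auto simp: field_simps)
    then show "\<exists>c. w = c \<cdot>\<^sub>v ?\<phi>" ..
  qed
  then show ?thesis using val by (intro exI[of _ sp]) (simp add: sp_def)
qed

lemma isotropic_five_settings:
  assumes ef: "e\<^sup>2 \<noteq> f\<^sup>2" "cmod e = 1" "cmod f = 1"
  shows "\<exists>P. verifies (bell_diag e e e f) P \<and> ordinary (bell_diag e e e f) P \<and> num_settings P = 5"
proof -
  define n where "n = (\<lambda>ab. if ab = (ket0, ket1) then 2 else 1 :: nat)"
  let ?U = "bell_diag e e e f"
  have U: "?U \<in> carrier_mat 4 4" "adj ?U * ?U = 1\<^sub>m 4" using ef by (auto intro: bell_diag_isometry)
  have sq: "e\<^sup>2 - f\<^sup>2 = (e + f) * (e - f)" by (simp add: power2_eq_square algebra_simps)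
  \<comment> \<open>These are the amplitudes of the output of \<open>(ket0, ket1)\<close>; both are
    nonzero exactly when that output is entangled.\<close>
  have pq: "(e + f) / 2 \<noteq> 0" "(e - f) / 2 \<noteq> 0" using ef(1) sq by auto
  have "cinner (?U *\<^sub>v kronv2 ket0 ket1) (?U *\<^sub>v kronv2 ket0 ket1) = 1"
    unfolding isometry_cinner[OF U kronv2_carrier(1,1)] using unit_kets by (intro unit_kronv2)
  then have "cnj ((e + f) / 2) * ((e + f) / 2) + cnj ((e - f) / 2) * ((e - f) / 2) = 1"
    unfolding isotropic_mult_kets cinner_vec4 by simp
  note two = two_setting_protocol[OF pq this, folded isotropic_mult_kets(4)]
  \<comment> \<open>Distinctness of the kets ensures that \<open>n\<close> takes the value 2 only
    once on \<open>kets\<close>, for a total of 1 + 1 + 1 + 2.\<close>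
  have ne: "ket0 \<noteq> ket1" "ket0 \<noteq> ket_plus"
  proof -
    have "ket0 $ 1 = 0" "ket1 $ 1 \<noteq> 0" "ket_plus $ 1 \<noteq> 0" by (simp_all add: ket_defs)
    then show "ket0 \<noteq> ket1" "ket0 \<noteq> ket_plus" by metis+
  qed
  have "unit_state 2 a \<and> unit_state 2 b \<and>
      (\<exists>sp. valid_state_protocol (?U *\<^sub>v kronv2 a b) sp \<and> positive_gap (?U *\<^sub>v kronv2 a b) sp \<and> length sp = n (a,b))"
    if "(a,b) \<in> set kets" for a b
  proof (cases "(a,b) = (ket0, ket1)")
    case True
    then show ?thesis using two unit_kets by (simp add: n_def)
  next
    case False
    then have ab: "(a,b) \<in> {(ket_plus, ket_plus), (ket0, ket0), (ket1, ket1)}"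
      using that by (auto simp: kets_def)
    then have "product_state (?U *\<^sub>v kronv2 a b)"
      using isotropic_product_output[OF ef(2), of "(a,b)"] by simp
    then obtain m where "valid_state_protocol (?U *\<^sub>v kronv2 a b) [m]" "positive_gap (?U *\<^sub>v kronv2 a b) [m]"
      by (rule product_state_protocol)
    then show ?thesis using ab unit_kets False by (auto simp: n_def intro!: exI[of _ "[m]"])
  qed
  moreover have "(ket_plus, ket_plus) \<in> set kets" by (simp add: kets_def)
  moreover have "sum_list (map n kets) = 5" using ne by (auto simp: kets_def n_def)
  ultimately show ?thesis
    using protocol_exists[OF U _ kets_span _ kets_hub, of n] by metis
qed

text \<open>Here \<open>f\<close> is \<open>e\<close> or \<open>-e\<close>, so up to a phase the
  operator is the identity or the swap, and even the output of \<open>(ket0, ket1)\<close> has a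
  single nonzero amplitude.\<close>

lemma isotropic_entanglement_free:
  assumes ef: "e\<^sup>2 = f\<^sup>2" "cmod e = 1" "cmod f = 1"
  shows "\<exists>P. verifies (bell_diag e e e f) P \<and> ordinary (bell_diag e e e f) P \<and> num_settings P = 4 \<and>
    entanglement_free (bell_diag e e e f) P"
proof -
  let ?U = "bell_diag e e e f"
  have U: "?U \<in> carrier_mat 4 4" "adj ?U * ?U = 1\<^sub>m 4" using ef by (auto intro: bell_diag_isometry)
  have "(e + f) * (e - f) = 0" using ef(1) by (simp add: power2_eq_square algebra_simps)
  moreover have "cinner (?U *\<^sub>v kronv2 ket0 ket1) (?U *\<^sub>v kronv2 ket0 ket1) = 1"
    unfolding isometry_cinner[OF U kronv2_carrier(1,1)] using unit_kets by (intro unit_kronv2)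
  ultimately have 01: "product_state (?U *\<^sub>v kronv2 ket0 ket1)"
    unfolding isotropic_mult_kets by (intro product_stateI) auto
  have "\<exists>P. verifies ?U P \<and> ordinary ?U P \<and> num_settings P = length kets \<and> entanglement_free ?U P"
  proof (rule entanglement_free_protocol_exists[OF U _ kets_span _ kets_hub])
    fix a b assume ab: "(a,b) \<in> set kets"
    then have "product_state (?U *\<^sub>v kronv2 a b)"
      using 01 isotropic_product_output[OF ef(2), of "(a,b)"] by (auto simp: kets_def)
    then show "unit_state 2 a \<and> unit_state 2 b \<and> product_state (?U *\<^sub>v kronv2 a b)"
      using ab unit_kets by (auto simp: kets_def)
  qed (auto simp: kets_def)
  moreover have "length kets = 4" by (simp add: kets_def)
  ultimately show ?thesis by simp
qed

section \<open>No three equal eigenvalues\<close>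

text \<open>For \<open>t = m\<^sup>2\<close> the conditions below read \<open>\<Sum>t = 0\<close> and \<open>\<Sum>z t = 0\<close>; they are solved by
  \<open>t1 = -z4/(z1 - z4)\<close>, \<open>t4 = z1/(z1 - z4)\<close>, \<open>t2 = z3/(z2 - z3)\<close>, \<open>t3 = -z2/(z2 - z3)\<close>.\<close>

lemma magic_coefficients:
  fixes z1 z2 z3 z4 :: complex
  assumes norm: "cmod z1 = 1" "cmod z2 = 1" "cmod z3 = 1" "cmod z4 = 1"
    and ne: "z1 \<noteq> z4" "z2 \<noteq> z3"
  obtains m1 m2 m3 m4 :: complex and p q :: real
  where "p > 0" "q > 0" "2 * p + 2 * q = 1"
    "cnj m1 * m1 = of_real p" "cnj m2 * m2 = of_real q" "cnj m3 * m3 = of_real q" "cnj m4 * m4 = of_real p"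
    "m1\<^sup>2 + m2\<^sup>2 + m3\<^sup>2 + m4\<^sup>2 = 0" "z1 * m1\<^sup>2 + z2 * m2\<^sup>2 + z3 * m3\<^sup>2 + z4 * m4\<^sup>2 = 0"
proof -
  \<comment> \<open>The moduli of the solutions stated above; dividing by \<open>N\<close> makes the
    squared moduli of the \<open>m1\<close>, ..., \<open>m4\<close> sum to 1.\<close>
  define r1 r2 where "r1 = 1 / cmod (z1 - z4)" and "r2 = 1 / cmod (z2 - z3)"
  have r: "r1 > 0" "r2 > 0" using ne by (simp_all add: r1_def r2_def)
  define N where "N = 2 * r1 + 2 * r2"
  have N: "N > 0" using r by (simp add: N_def)
  define t1 t2 t3 t4 where "t1 = - z4 / (z1 - z4) / of_real N" and "t2 = z3 / (z2 - z3) / of_real N"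
    and "t3 = - z2 / (z2 - z3) / of_real N" and "t4 = z1 / (z1 - z4) / of_real N"
  have t: "cmod t1 = r1 / N" "cmod t2 = r2 / N" "cmod t3 = r2 / N" "cmod t4 = r1 / N"
    using norm N by (simp_all add: t1_def t2_def t3_def t4_def r1_def r2_def norm_divide norm_mult)
  have c: "cnj (csqrt t) * csqrt t = of_real (cmod t)" for t
  proof -
    have "cnj (csqrt t) * csqrt t = of_real ((cmod (csqrt t))\<^sup>2)"
      by (simp only: complex_norm_square mult.commute)
    then show ?thesis by (simp only: norm_power[symmetric] power2_csqrt)
  qed
  have d: "z1 - z4 \<noteq> 0" "z2 - z3 \<noteq> 0" using ne by auto
  \<comment> \<open>Each pair solves the weighted equation by itself, and the unweighted sums 1/N
    and -1/N of the two pairs cancel.\<close>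
  have s1: "t1 + t4 = 1 / of_real N" "z1 * t1 + z4 * t4 = 0"
    using d by (simp_all add: t1_def t4_def diff_divide_distrib[symmetric] add_divide_distrib[symmetric] mult.commute)
  have "t2 + t3 = (z3 - z2) / (z2 - z3) / of_real N"
    by (simp add: t2_def t3_def diff_divide_distrib)
  moreover have "(z3 - z2) / (z2 - z3) = - 1" using d by (simp add: divide_eq_minus_1_iff)
  ultimately have s2: "t2 + t3 = - 1 / of_real N" "z2 * t2 + z3 * t3 = 0"
    by (simp_all add: t2_def t3_def mult.commute)
  show ?thesis
  proof (rule that[of "r1 / N" "r2 / N" "csqrt t1" "csqrt t2" "csqrt t3" "csqrt t4"])
    show "2 * (r1 / N) + 2 * (r2 / N) = 1"
      using N by (simp add: N_def add_divide_distrib[symmetric])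
    have "t1 + t2 + t3 + t4 = (t1 + t4) + (t2 + t3)" by simp
    then show "(csqrt t1)\<^sup>2 + (csqrt t2)\<^sup>2 + (csqrt t3)\<^sup>2 + (csqrt t4)\<^sup>2 = 0"
      unfolding power2_csqrt s1 s2 by simp
    have "z1 * t1 + z2 * t2 + z3 * t3 + z4 * t4 = (z1 * t1 + z4 * t4) + (z2 * t2 + z3 * t3)" by simp
    then show "z1 * (csqrt t1)\<^sup>2 + z2 * (csqrt t2)\<^sup>2 + z3 * (csqrt t3)\<^sup>2 + z4 * (csqrt t4)\<^sup>2 = 0"
      unfolding power2_csqrt s1 s2 by simp
  qed (use r N c t in auto)
qed

text \<open>In magic coordinates the output is \<open>(x m1, y m2, z m3, t m4)\<close>, so its
  concurrence involves the squared eigenvalues; these play the role of \<open>z1\<close>, ...,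
  \<open>z4\<close> in \<open>magic_coefficients\<close>.\<close>

lemma generic_entanglement_free:
  assumes norm: "cmod x = 1" "cmod y = 1" "cmod z = 1" "cmod t = 1"
    and ne: "x\<^sup>2 \<noteq> t\<^sup>2" "y\<^sup>2 \<noteq> z\<^sup>2"
  shows "\<exists>P. verifies (bell_diag x y z t) P \<and> ordinary (bell_diag x y z t) P \<and> num_settings P = 4 \<and>
    entanglement_free (bell_diag x y z t) P"
proof -
  let ?U = "bell_diag x y z t"
  have U: "?U \<in> carrier_mat 4 4" "adj ?U * ?U = 1\<^sub>m 4" using norm by (auto intro: bell_diag_isometry)
  have "cmod (x\<^sup>2) = 1" "cmod (y\<^sup>2) = 1" "cmod (z\<^sup>2) = 1" "cmod (t\<^sup>2) = 1"
    using norm by (simp_all add: norm_power)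
  then obtain m1 m2 m3 m4 :: complex and p q :: real
    where pq: "p > 0" "q > 0" "2 * p + 2 * q = 1"
    and m: "cnj m1 * m1 = of_real p" "cnj m2 * m2 = of_real q" "cnj m3 * m3 = of_real q" "cnj m4 * m4 = of_real p"
    and s: "m1\<^sup>2 + m2\<^sup>2 + m3\<^sup>2 + m4\<^sup>2 = 0" "x\<^sup>2 * m1\<^sup>2 + y\<^sup>2 * m2\<^sup>2 + z\<^sup>2 * m3\<^sup>2 + t\<^sup>2 * m4\<^sup>2 = 0"
    using magic_coefficients[of "x\<^sup>2" "y\<^sup>2" "z\<^sup>2" "t\<^sup>2"] ne by metis
  have sum: "complex_of_real p + of_real q + of_real q + of_real p = 1"
    using pq(3) by (simp flip: of_real_add)
  \<comment> \<open>Both product conditions and the norm depend only on squares and moduli, which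
    sign changes preserve.\<close>
  have prod: "product_state (magic (e1 * m1) (e2 * m2) (e3 * m3) (e4 * m4)) \<and>
      product_state (?U *\<^sub>v magic (e1 * m1) (e2 * m2) (e3 * m3) (e4 * m4))"
    if e: "e1 \<in> {1,-1}" "e2 \<in> {1,-1}" "e3 \<in> {1,-1}" "e4 \<in> {1,-1}" for e1 e2 e3 e4
  proof -
    have e2: "(e * m)\<^sup>2 = m\<^sup>2" "(u * (e * m))\<^sup>2 = u\<^sup>2 * m\<^sup>2" "cnj (e * m) * (e * m) = cnj m * m"
      if "e \<in> {1,-1}" for e m u :: complex
      using that by (auto simp: power_mult_distrib)
    have u: "cnj (u * v) * (u * v) = cnj v * v" if "cmod u = 1" for u v
    proof -
      have "cnj u * u = 1" using complex_norm_square[of u] that by (simp add: mult.commute)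
      moreover have "cnj (u * v) * (u * v) = (cnj u * u) * (cnj v * v)" by simp
      ultimately show ?thesis by simp
    qed
    show ?thesis
      unfolding bell_diag_mult_magic
      by (intro conjI product_state_magicI; simp only: e2 e u norm m s sum)
  qed
  have "\<forall>v. \<exists>ab. product_state v \<longrightarrow>
      unit_state 2 (fst ab) \<and> unit_state 2 (snd ab) \<and> kronv2 (fst ab) (snd ab) = v"
    unfolding product_state_def by (metis fst_conv snd_conv)
  from choice[OF this] obtain f where f: "unit_state 2 (fst (f v)) \<and> unit_state 2 (snd (f v)) \<and>
      kronv2 (fst (f v)) (snd (f v)) = v" if "product_state v" for v
    by blast
  \<comment> \<open>Subtracting a vector with one flipped sign from the first isolates one
    coordinate. As all coordinates are nonzero, the four vectors span.\<close>
  define vs where "vs = [magic m1 m2 m3 m4, magic m1 (- m2) m3 m4, magic m1 m2 (- m3) m4, magic m1 m2 m3 (- m4)]"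
  have vs: "product_state v \<and> product_state (?U *\<^sub>v v)" if v: "v \<in> set vs" for v
  proof -
    note signs = prod[of 1 1 1 1, simplified] prod[of 1 "-1" 1 1, simplified] prod[of 1 1 "-1" 1, simplified]
      prod[of 1 1 1 "-1", simplified]
    consider "v = magic m1 m2 m3 m4" | "v = magic m1 (- m2) m3 m4" | "v = magic m1 m2 (- m3) m4"
      | "v = magic m1 m2 m3 (- m4)"
      using v unfolding vs_def by auto
    then show ?thesis using signs by cases simp_all
  qed
  have kf: "kronv2 a b = v" if "(a,b) = f v" "v \<in> set vs" for a b v
    using f[of v] vs[OF that(2)] that(1) by (metis fst_conv snd_conv)
  define v0 where "v0 = magic m1 m2 m3 m4"
  have v0: "v0 \<in> set vs" by (simp add: v0_def vs_def)
  have "\<exists>P. verifies ?U P \<and> ordinary ?U P \<and> num_settings P = length (map f vs) \<and> entanglement_free ?U P"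
  proof (rule entanglement_free_protocol_exists[OF U, of _ "fst (f v0)" "snd (f v0)"])
    fix a b assume "(a,b) \<in> set (map f vs)"
    then obtain v where v: "(a,b) = f v" "v \<in> set vs" by auto
    then show "unit_state 2 a \<and> unit_state 2 b \<and> product_state (?U *\<^sub>v kronv2 a b)"
      using f[of v] vs[of v] kf[OF v] by (metis fst_conv snd_conv)
  next
    show "(fst (f v0), snd (f v0)) \<in> set (map f vs)" using v0 by simp
    have "cinner v0 v \<noteq> 0" if "v \<in> set vs" for v
    proof -
      \<comment> \<open>Flipping the second or third sign leaves 1 - 2q = 2p, flipping the fourth
        leaves 1 - 2p = 2q, both positive; so the unflipped vector is a hub.\<close>
      have "cinner v0 v \<in> {of_real (2 * p + 2 * q), of_real (2 * p), of_real (2 * q)}"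
        using that by (auto simp: v0_def vs_def cinner_magic m)
      then show ?thesis using pq by auto
    qed
    then show "\<forall>(a,b)\<in>set (map f vs). cinner (kronv2 (fst (f v0)) (snd (f v0))) (kronv2 a b) \<noteq> 0"
      using kf[of "fst (f v0)" "snd (f v0)" v0] v0 kf[OF surjective_pairing[symmetric]]
      by (auto simp: case_prod_unfold)
  next
    fix w assume w: "w \<in> carrier_vec 4" "\<forall>(a,b)\<in>set (map f vs). cinner (kronv2 a b) w = 0"
    obtain n1 n2 n3 n4 where wn: "w = magic n1 n2 n3 n4" using w(1) by (rule magic_cases)
    have "cinner v w = 0" if "v \<in> set vs" for v
      using w(2) that kf[of "fst (f v)" "snd (f v)" v] by (auto simp: case_prod_unfold)
    then have "\<forall>v\<in>set vs. cinner v w = 0" by blast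
    then have o: "cnj m1 * n1 + cnj m2 * n2 + cnj m3 * n3 + cnj m4 * n4 = 0"
      "cnj m1 * n1 - cnj m2 * n2 + cnj m3 * n3 + cnj m4 * n4 = 0"
      "cnj m1 * n1 + cnj m2 * n2 - cnj m3 * n3 + cnj m4 * n4 = 0"
      "cnj m1 * n1 + cnj m2 * n2 + cnj m3 * n3 - cnj m4 * n4 = 0"
      by (simp_all add: vs_def wn cinner_magic del: right_minus_eq)
    have "b = 0 \<and> c = 0 \<and> d = 0"
      if "a + b + c + d = 0" "a - b + c + d = 0" "a + b - c + d = 0" "a + b + c - d = 0" for a b c d :: complex
    proof -
      have "2 * b = (a + b + c + d) - (a - b + c + d)" "2 * c = (a + b + c + d) - (a + b - c + d)"
        "2 * d = (a + b + c + d) - (a + b + c - d)" by (simp_all add: algebra_simps)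
      then show ?thesis unfolding that by simp
    qed
    from this[OF o] have "cnj m2 * n2 = 0" "cnj m3 * n3 = 0" "cnj m4 * n4 = 0" by simp_all
    moreover have "m1 \<noteq> 0" "m2 \<noteq> 0" "m3 \<noteq> 0" "m4 \<noteq> 0" using m pq by auto
    ultimately have "n1 = 0" "n2 = 0" "n3 = 0" "n4 = 0" using o(1) by auto
    then show "w = 0\<^sub>v 4" by (simp add: wn magic_zero)
  qed
  moreover have "length (map f vs) = 4" by (simp add: vs_def)
  ultimately show ?thesis by simp
qed

section \<open>The phases of the canonical unitary and the final count\<close>

lemma cis_neq_1:
  assumes "0 < \<theta>" "\<theta> < 2 * pi"
  shows "cis \<theta> \<noteq> 1"
proof
  assume "cis \<theta> = 1"
  then have "cos (2 * (\<theta> / 2)) = 1" by (simp add: complex_eq_iff)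
  then have "sin (\<theta> / 2) = 0" unfolding cos_double_sin by simp
  moreover have "sin (\<theta> / 2) > 0" using assms by (intro sin_gt_zero) auto
  ultimately show False by simp
qed

lemma cis_power2_neq:
  assumes "0 < a - b" "a - b < pi"
  shows "(cis a)\<^sup>2 \<noteq> (cis b)\<^sup>2"
proof
  assume "(cis a)\<^sup>2 = (cis b)\<^sup>2"
  then have "cis (2 * a) = cis (2 * b)" by (simp add: DeMoivre)
  then have "cis (2 * (a - b)) = 1" by (simp add: cis_divide[symmetric] right_diff_distrib)
  then show False using cis_neq_1[of "2 * (a - b)"] assms by simp
qed

lemma canonical_U_isometry:
  "canonical_U a1 a2 a3 \<in> carrier_mat 4 4" "adj (canonical_U a1 a2 a3) * canonical_U a1 a2 a3 = 1\<^sub>m 4"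
  unfolding canonical_U_bell_diag by (auto intro!: bell_diag_isometry)

lemma mu_eqI:
  assumes "verifies U P" "ordinary U P" "num_settings P = n"
    and "\<And>P. verifies U P \<Longrightarrow> ordinary U P \<Longrightarrow> n \<le> num_settings P"
  shows "mu U = n"
  unfolding mu_def using assms by (intro Least_equality) auto

text \<open>If \<open>a1 = a3\<close>, all parameters agree and only 0 and pi/4 remain. Otherwise
  the arguments of the paired eigenvalues differ by 2(a1 + a3) and 2(a1 - a3), both strictly between
  0 and pi, so their squares differ.\<close>

lemma canonical_U_EF:
  assumes "0 \<le> a3" "a3 \<le> a2" "a2 \<le> a1" "a1 \<le> pi / 4" and EF: "(a1, a2, a3) \<in> S_EF"
  shows "\<exists>P. verifies (canonical_U a1 a2 a3) P \<and> ordinary (canonical_U a1 a2 a3) P \<and> num_settings P = 4 \<and>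
    entanglement_free (canonical_U a1 a2 a3) P"
proof (cases "a1 = a3")
  case True
  then have eq: "a2 = a1" "a3 = a1" using assms by auto
  then have "a1 = 0 \<or> a1 = pi / 4"
    using EF assms by (auto simp: S_EF_def S_E_def)
  then have "cis (- a1) ^ 2 = cis (3 * a1) ^ 2"
  proof
    assume a: "a1 = pi / 4"
    \<comment> \<open>At pi/4 the doubled arguments 3 pi/2 and -pi/2 differ by a full turn.\<close>
    have "cis (2 * (3 * a1)) = cis (2 * pi + 2 * (- a1))"
      using a by (intro arg_cong[where f = cis]) simp
    also have "\<dots> = cis (2 * (- a1))" unfolding cis_mult[symmetric] by simp
    finally show ?thesis by (simp add: DeMoivre)
  qed simp
  from isotropic_entanglement_free[OF this] show ?thesis
    by (simp add: canonical_U_bell_diag eq)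
next
  case False
  then have lt: "a3 < a1" using assms by auto
  have "(cis (a2 - a1 - a3))\<^sup>2 \<noteq> (cis (a1 + a2 + a3))\<^sup>2"
    using cis_power2_neq[of "a1 + a2 + a3" "a2 - a1 - a3"] assms lt by force
  moreover have "(cis (a1 - a2 - a3))\<^sup>2 \<noteq> (cis (a3 - a1 - a2))\<^sup>2"
    using assms lt pi_gt_zero by (intro cis_power2_neq) linarith+
  ultimately show ?thesis
    unfolding canonical_U_bell_diag by (intro generic_entanglement_free) simp_all
qed

theorem theorem5:
  fixes a1 a2 a3 :: real
  assumes "0 \<le> a3" and "a3 \<le> a2" and "a2 \<le> a1" and "a1 \<le> pi / 4"
  shows "((a1, a2, a3) \<in> S_EF \<longrightarrow> mu (canonical_U a1 a2 a3) = 4)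
       \<and> ((a1, a2, a3) \<in> S_E \<longrightarrow> mu (canonical_U a1 a2 a3) = 5)
       \<and> ((\<exists>P. verifies (canonical_U a1 a2 a3) P \<and> entanglement_free (canonical_U a1 a2 a3) P)
            \<longleftrightarrow> (a1, a2, a3) \<in> S_EF)"
proof -
  let ?U = "canonical_U a1 a2 a3"
  note U = canonical_U_isometry[of a1 a2 a3]
  note EF = canonical_U_EF[OF assms]
  have four: "mu ?U = 4" if EF': "(a1, a2, a3) \<in> S_EF"
    using EF[OF EF'] verifies_num_settings(1)[OF U] by (auto intro: mu_eqI)
  have E: "mu ?U = 5 \<and> (\<nexists>P. verifies ?U P \<and> entanglement_free ?U P)" if E: "(a1, a2, a3) \<in> S_E"
  proof -
    have eq: "a2 = a1" "a3 = a1" and a: "0 < a1" "a1 < pi / 4" using E by (auto simp: S_E_def)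
    have U_iso: "?U = bell_diag (cis (- a1)) (cis (- a1)) (cis (- a1)) (cis (3 * a1))"
      by (simp add: canonical_U_bell_diag eq)
    \<comment> \<open>The arguments differ by 4 a1, which lies strictly between 0 and pi.\<close>
    have ne: "(cis (- a1))\<^sup>2 \<noteq> (cis (3 * a1))\<^sup>2"
      using cis_power2_neq[of "3 * a1" "- a1"] a by force
    note some_entangled = isotropic_not_all_product[OF ne norm_cis norm_cis, folded U_iso]
    have "5 \<le> num_settings P" if ver: "verifies ?U P" and ord: "ordinary ?U P" for P
    proof (rule ccontr)
      assume "\<not> 5 \<le> num_settings P"
      \<comment> \<open>With four settings every output state would have a single one and hence be a
        product state, whereas one of the outputs is entangled.\<close>
      then have 4: "num_settings P = 4" using verifies_num_settings(1)[OF U ver] by simp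
      obtain a b sp where P: "((a,b),sp) \<in> set P" and np: "\<not> product_state (?U *\<^sub>v kronv2 a b)"
        using some_entangled[OF ver] by auto
      have "length sp = 1" using verifies_num_settings(2)[OF U ver 4 P] .
      moreover have "valid_state_protocol (?U *\<^sub>v kronv2 a b) sp" "positive_gap (?U *\<^sub>v kronv2 a b) sp"
        "unit_state 2 a" "unit_state 2 b"
        using ver ord P by (auto simp: verifies_def valid_protocol_def ordinary_def)
      moreover have "cinner (?U *\<^sub>v kronv2 a b) (?U *\<^sub>v kronv2 a b) = 1"
        using calculation by (simp add: isometry_cinner[OF U] unit_kronv2)
      ultimately have "product_state (?U *\<^sub>v kronv2 a b)"
        using U(1) by (intro single_setting_product[of _ sp]) (auto intro: mult_mat_vec_carrier)
      with np show False ..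
    qed
    moreover obtain P where "verifies ?U P" "ordinary ?U P" "num_settings P = 5"
      using isotropic_five_settings[OF ne, folded U_iso] by auto
    ultimately have "mu ?U = 5" by (intro mu_eqI)
    moreover have "\<not> entanglement_free ?U P" if ver: "verifies ?U P" for P
    proof -
      obtain a b sp where "((a,b),sp) \<in> set P" "\<not> product_state (?U *\<^sub>v kronv2 a b)"
        using some_entangled[OF ver] by auto
      then show ?thesis unfolding entanglement_free_def by blast
    qed
    ultimately show ?thesis by blast
  qed
  have "(a1, a2, a3) \<in> S_EF \<longleftrightarrow> (a1, a2, a3) \<notin> S_E"
    using assms by (auto simp: S_EF_def S_region_def)
  then show ?thesis using four E EF by blast
qed

end
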